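(* Let $G$ be a $3$-dimensional unimodular Lie group equipped with a left invariant Riemannian metric $g$, and suppose that its Lie algebra $\mathfrak{g}$ admits an orthonormal basis $\{e_1,e_2,e_3\}$ satisfying \[ [e_1,e_2]=c_3e_3,\quad [e_2,e_3]=c_1e_1,\quad [e_3,e_1]=c_2e_2, \] where the real constants $c_1,c_2,c_3$ are pairwise distinct. Then there exists a unique homogeneous Riemannian structure $S$ on $(G,g)$. The homogeneous Riemannian structure $S$ is left invariant, and its Ambrose-Singer connection $\tilde{\nabla}=\nabla+S$ coincides with the Cartan-Schouten $(-)$-connection $\nabla^{(-)}$ of $G$.
   Context: Let $(M,g)$ be a Riemannian manifold with Levi-Civita connection $\nabla$ and Riemannian curvature $R(X,Y)=[\nabla_X,\nabla_Y]-\nabla_{[X,Y]}$. A homogeneous Riemannian structure on $(M,g)$ is a (smooth) tensor field $S$ of type $(1,2)$ on $M$ such that the linear connection $\tilde{\nabla}=\nabla+S$, i.e. $\tilde\nabla_XY=\nabla_XY+S(X)Y$, satisfies \[ \tilde{\nabla}g=0,\quad \tilde{\nabla}R=0,\quad \tilde{\nabla}S=0. \] The connection $\tilde{\nabla}$ is then called the Ambrose-Singer connection of $S$. No left invariance of $S$ is assumed in the definition. For a Lie group $G$ with Lie algebra $\mathfrak{g}$ of left invariant vector fields, the Cartan-Schouten $(-)$-connection $\nabla^{(-)}$ is the linear connection on $G$ determined by $\nabla^{(-)}_XY=0$ for all left invariant vector fields $X,Y\in\mathfrak{g}$. A basis as in the claim is called a unimodular basis; elements of $\mathfrak g$ are regarded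 as left invariant vector fields and orthonormality is with respect to $g$. *)

theory Defs
  imports "HOL-Analysis.Analysis" "HOL-Library.Function_Algebras"
begin

text \<open>Pointwise scalar multiplication. Together with \<^theory>\<open>HOL-Library.Function_Algebras\<close> it
  makes tangent vectors, vector fields, etc. (all represented as functions) elements of a real
  vector space, so that \<^const>\<open>span\<close> and \<^const>\<open>independent\<close> apply to them.\<close>

instantiation "fun" :: (type, real_vector) real_vector
begin

definition "scaleR (r::real) f = (\<lambda>x. r *\<^sub>R f x)"

instance
  by standard (simp_all add: scaleR_fun_def fun_eq_iff scaleR_add_right scaleR_add_left)

end

section \<open>Smooth manifolds\<close>

text \<open>These two notions are meant for open sets only.\<close>

primrec Ck_on :: "nat \<Rightarrow> ('e::real_normed_vector \<Rightarrow> 'f::real_normed_vector) \<Rightarrow> 'e set \<Rightarrow> bool" where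
  "Ck_on 0 f S = continuous_on S f"
| "Ck_on (Suc k) f S = ((\<forall>x\<in>S. f differentiable (at x)) \<and>
     (\<forall>v. Ck_on k (\<lambda>x. frechet_derivative f (at x) v) S))"

definition smooth_on :: "'e::real_normed_vector set \<Rightarrow> ('e \<Rightarrow> 'f::real_normed_vector) \<Rightarrow> bool" where
  "smooth_on S f \<longleftrightarrow> (\<forall>k. Ck_on k f S)"

text \<open>A chart is a pair of its domain and its coordinate map; the values of the coordinate map
  outside the domain are irrelevant. Atlases need not be maximal.\<close>

type_synonym ('a, 'e) atlas = "('a set \<times> ('a \<Rightarrow> 'e)) set"

definition smooth_atlas ::
    "('a::{t2_space,second_countable_topology}, 'e::euclidean_space) atlas \<Rightarrow> bool" where
  "smooth_atlas A \<longleftrightarrow>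
     (\<Union>(U, \<phi>)\<in>A. U) = UNIV \<and>
     (\<forall>(U, \<phi>)\<in>A. open U \<and> open (\<phi> ` U) \<and> homeomorphism U (\<phi> ` U) \<phi> (inv_into U \<phi>)) \<and>
     (\<forall>(U, \<phi>)\<in>A. \<forall>(V, \<psi>)\<in>A. smooth_on (\<phi> ` (U \<inter> V)) (\<psi> \<circ> inv_into U \<phi>))"

definition smooth_map_on ::
    "('a::topological_space, 'e::euclidean_space) atlas \<Rightarrow>
     ('b::topological_space, 'f::euclidean_space) atlas \<Rightarrow> 'a set \<Rightarrow> ('a \<Rightarrow> 'b) \<Rightarrow> bool" where
  "smooth_map_on A B S F \<longleftrightarrow> continuous_on S F \<and>
     (\<forall>(U, \<phi>)\<in>A. \<forall>(V, \<psi>)\<in>B.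
        smooth_on (\<phi> ` (U \<inter> S \<inter> F -` V)) (\<psi> \<circ> F \<circ> inv_into U \<phi>))"

definition prod_atlas :: "('a, 'e) atlas \<Rightarrow> ('b, 'f) atlas \<Rightarrow> ('a \<times> 'b, 'e \<times> 'f) atlas" where
  "prod_atlas A B = {(U \<times> V, map_prod \<phi> \<psi>) | U \<phi> V \<psi>. (U, \<phi>) \<in> A \<and> (V, \<psi>) \<in> B}"

definition real_atlas :: "(real, real) atlas" where
  "real_atlas = {(UNIV, id)}"

definition smooth_functions ::
    "('a::topological_space, 'e::euclidean_space) atlas \<Rightarrow> ('a \<Rightarrow> real) set" where
  "smooth_functions A = {f. smooth_map_on A real_atlas UNIV f}"


section \<open>Tangent vectors, vector fields, tensor fields\<close>

text \<open>A tangent vector is the directional derivative operator on smooth functions given by the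
  velocity of a smooth curve. As operators are total functions here, they are normalised to be
  0 on non-smooth functions, so that equality of tangent vectors is equality in HOL.\<close>

type_synonym 'a tvec = "('a \<Rightarrow> real) \<Rightarrow> real"
type_synonym 'a vfield = "'a \<Rightarrow> 'a tvec"

definition velocity ::
    "('a::topological_space, 'e::euclidean_space) atlas \<Rightarrow> (real \<Rightarrow> 'a) \<Rightarrow> 'a tvec" where
  "velocity A \<gamma> = (\<lambda>f. if f \<in> smooth_functions A then deriv (\<lambda>t. f (\<gamma> t)) 0 else 0)"

definition tangent_space ::
    "('a::topological_space, 'e::euclidean_space) atlas \<Rightarrow> 'a \<Rightarrow> 'a tvec set" where
  "tangent_space A p =
     {velocity A \<gamma> | \<gamma> \<epsilon>. \<epsilon> > 0 \<and> \<gamma> 0 = p \<and> smooth_map_on real_atlas A {-\<epsilon><..<\<epsilon>} \<gamma>}"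

text \<open>For a diffeomorphism F, f is smooth iff f o F is, so the following respects the above
  normalisation; it will only be used for left translations.\<close>

definition pushforward :: "('a \<Rightarrow> 'a) \<Rightarrow> 'a tvec \<Rightarrow> 'a tvec" where
  "pushforward F v = (\<lambda>f. v (f \<circ> F))"

definition deriv_along :: "'a vfield \<Rightarrow> ('a \<Rightarrow> real) \<Rightarrow> ('a \<Rightarrow> real)" where
  "deriv_along X f = (\<lambda>p. X p f)"

definition vector_fields ::
    "('a::topological_space, 'e::euclidean_space) atlas \<Rightarrow> 'a vfield set" where
  "vector_fields A = {X. (\<forall>p. X p \<in> tangent_space A p) \<and>
     (\<forall>f\<in>smooth_functions A. deriv_along X f \<in> smooth_functions A)}"

definition fmul :: "('a \<Rightarrow> real) \<Rightarrow> 'a vfield \<Rightarrow> 'a vfield" where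
  "fmul h X = (\<lambda>p. h p *\<^sub>R X p)"

definition bracket :: "'a vfield \<Rightarrow> 'a vfield \<Rightarrow> 'a vfield" where
  "bracket X Y = (\<lambda>p f. X p (deriv_along Y f) - Y p (deriv_along X f))"

type_synonym 'a tensor02 = "'a \<Rightarrow> 'a tvec \<Rightarrow> 'a tvec \<Rightarrow> real"
type_synonym 'a tensor12 = "'a \<Rightarrow> 'a tvec \<Rightarrow> 'a tvec \<Rightarrow> 'a tvec"

text \<open>Evaluation on vector fields, for tensor fields of either type.\<close>

definition ev :: "('a \<Rightarrow> 'a tvec \<Rightarrow> 'a tvec \<Rightarrow> 'c) \<Rightarrow> 'a vfield \<Rightarrow> 'a vfield \<Rightarrow> 'a \<Rightarrow> 'c" where
  "ev T X Y = (\<lambda>p. T p (X p) (Y p))"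

definition bilinear_at ::
    "('a::topological_space, 'e::euclidean_space) atlas \<Rightarrow> 'a \<Rightarrow>
     ('a tvec \<Rightarrow> 'a tvec \<Rightarrow> 'c::real_vector) \<Rightarrow> bool" where
  "bilinear_at A p b \<longleftrightarrow>
     (\<forall>u\<in>tangent_space A p. \<forall>v\<in>tangent_space A p. \<forall>w\<in>tangent_space A p. \<forall>r s::real.
        b (r *\<^sub>R u + s *\<^sub>R v) w = r *\<^sub>R b u w + s *\<^sub>R b v w \<and>
        b w (r *\<^sub>R u + s *\<^sub>R v) = r *\<^sub>R b w u + s *\<^sub>R b w v)"

definition riemannian_metric ::
    "('a::topological_space, 'e::euclidean_space) atlas \<Rightarrow> 'a tensor02 \<Rightarrow> bool" where
  "riemannian_metric A g \<longleftrightarrow>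
     (\<forall>p. bilinear_at A p (g p) \<and>
        (\<forall>u\<in>tangent_space A p. \<forall>v\<in>tangent_space A p. g p u v = g p v u) \<and>
        (\<forall>u\<in>tangent_space A p. u \<noteq> 0 \<longrightarrow> g p u u > 0)) \<and>
     (\<forall>X\<in>vector_fields A. \<forall>Y\<in>vector_fields A. ev g X Y \<in> smooth_functions A)"

text \<open>A tensor field of type (1,2), written S(X)Y in the literature and
  \<open>ev S X Y\<close> here. The second conjunct normalises the irrelevant values of S on arguments which
  are not tangent vectors, so that equality of tensor fields is equality in HOL.\<close>

definition tensor_field12 ::
    "('a::topological_space, 'e::euclidean_space) atlas \<Rightarrow> 'a tensor12 \<Rightarrow> bool" where
  "tensor_field12 A S \<longleftrightarrow>
     (\<forall>p. bilinear_at A p (S p) \<and>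
        (\<forall>u v. \<not> (u \<in> tangent_space A p \<and> v \<in> tangent_space A p) \<longrightarrow> S p u v = 0) \<and>
        (\<forall>u\<in>tangent_space A p. \<forall>v\<in>tangent_space A p. S p u v \<in> tangent_space A p)) \<and>
     (\<forall>X\<in>vector_fields A. \<forall>Y\<in>vector_fields A. ev S X Y \<in> vector_fields A)"


section \<open>Linear connections\<close>

type_synonym 'a connection = "'a vfield \<Rightarrow> 'a vfield \<Rightarrow> 'a vfield"

text \<open>Again the last conjunct only normalises irrelevant values.\<close>

definition linear_connection ::
    "('a::topological_space, 'e::euclidean_space) atlas \<Rightarrow> 'a connection \<Rightarrow> bool" where
  "linear_connection A D \<longleftrightarrow>
     (\<forall>X\<in>vector_fields A. \<forall>Y\<in>vector_fields A. D X Y \<in> vector_fields A) \<and>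
     (\<forall>X\<in>vector_fields A. \<forall>Y\<in>vector_fields A. \<forall>Z\<in>vector_fields A.
        D (X + Y) Z = D X Z + D Y Z \<and> D X (Y + Z) = D X Y + D X Z) \<and>
     (\<forall>X\<in>vector_fields A. \<forall>Y\<in>vector_fields A. \<forall>h\<in>smooth_functions A.
        D (fmul h X) Y = fmul h (D X Y) \<and>
        D X (fmul h Y) = fmul (deriv_along X h) Y + fmul h (D X Y)) \<and>
     (\<forall>X Y. \<not> (X \<in> vector_fields A \<and> Y \<in> vector_fields A) \<longrightarrow> D X Y = 0)"

definition torsion_free ::
    "('a::topological_space, 'e::euclidean_space) atlas \<Rightarrow> 'a connection \<Rightarrow> bool" where
  "torsion_free A D \<longleftrightarrow>
     (\<forall>X\<in>vector_fields A. \<forall>Y\<in>vector_fields A. D X Y - D Y X = bracket X Y)"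

definition parallel_metric ::
    "('a::topological_space, 'e::euclidean_space) atlas \<Rightarrow> 'a connection \<Rightarrow> 'a tensor02 \<Rightarrow> bool" where
  "parallel_metric A D g \<longleftrightarrow>
     (\<forall>X\<in>vector_fields A. \<forall>Y\<in>vector_fields A. \<forall>Z\<in>vector_fields A.
        deriv_along X (ev g Y Z) - ev g (D X Y) Z - ev g Y (D X Z) = 0)"

definition parallel_tensor12 ::
    "('a::topological_space, 'e::euclidean_space) atlas \<Rightarrow> 'a connection \<Rightarrow> 'a tensor12 \<Rightarrow> bool" where
  "parallel_tensor12 A D S \<longleftrightarrow>
     (\<forall>X\<in>vector_fields A. \<forall>Y\<in>vector_fields A. \<forall>Z\<in>vector_fields A.
        D X (ev S Y Z) - ev S (D X Y) Z - ev S Y (D X Z) = 0)"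

definition curvature :: "'a connection \<Rightarrow> 'a vfield \<Rightarrow> 'a vfield \<Rightarrow> 'a vfield \<Rightarrow> 'a vfield" where
  "curvature D X Y Z = D X (D Y Z) - D Y (D X Z) - D (bracket X Y) Z"

definition parallel_curvature ::
    "('a::topological_space, 'e::euclidean_space) atlas \<Rightarrow> 'a connection \<Rightarrow>
     ('a vfield \<Rightarrow> 'a vfield \<Rightarrow> 'a vfield \<Rightarrow> 'a vfield) \<Rightarrow> bool" where
  "parallel_curvature A D R \<longleftrightarrow>
     (\<forall>X\<in>vector_fields A. \<forall>Y\<in>vector_fields A. \<forall>Z\<in>vector_fields A. \<forall>W\<in>vector_fields A.
        D X (R Y Z W) - R (D X Y) Z W - R Y (D X Z) W - R Y Z (D X W) = 0)"

definition levi_civita ::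
    "('a::topological_space, 'e::euclidean_space) atlas \<Rightarrow> 'a tensor02 \<Rightarrow> 'a connection" where
  "levi_civita A g = (THE D. linear_connection A D \<and> torsion_free A D \<and> parallel_metric A D g)"


section \<open>Homogeneous Riemannian structures\<close>

definition ambrose_singer ::
    "('a::topological_space, 'e::euclidean_space) atlas \<Rightarrow> 'a tensor02 \<Rightarrow> 'a tensor12 \<Rightarrow>
     'a connection" where
  "ambrose_singer A g S = (\<lambda>X Y. if X \<in> vector_fields A \<and> Y \<in> vector_fields A
     then levi_civita A g X Y + ev S X Y else 0)"

definition homogeneous_structure ::
    "('a::topological_space, 'e::euclidean_space) atlas \<Rightarrow> 'a tensor02 \<Rightarrow> 'a tensor12 \<Rightarrow> bool" where
  "homogeneous_structure A g S \<longleftrightarrow>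
     tensor_field12 A S \<and>
     parallel_metric A (ambrose_singer A g S) g \<and>
     parallel_curvature A (ambrose_singer A g S) (curvature (levi_civita A g)) \<and>
     parallel_tensor12 A (ambrose_singer A g S) S"


section \<open>Lie groups\<close>

definition lie_group ::
    "('a::{t2_space,second_countable_topology}, 'e::euclidean_space) atlas \<Rightarrow>
     ('a \<Rightarrow> 'a \<Rightarrow> 'a) \<Rightarrow> 'a \<Rightarrow> ('a \<Rightarrow> 'a) \<Rightarrow> bool" where
  "lie_group A m one iv \<longleftrightarrow> smooth_atlas A \<and> group m one iv \<and>
     smooth_map_on (prod_atlas A A) A UNIV (\<lambda>(x, y). m x y) \<and>
     smooth_map_on A A UNIV iv"

text \<open>On a second countable locally compact Hausdorff space, regularity of a Borel measure which
  is finite on compact sets is automatic.\<close>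

definition left_haar_measure ::
    "('a::topological_space \<Rightarrow> 'a \<Rightarrow> 'a) \<Rightarrow> 'a measure \<Rightarrow> bool" where
  "left_haar_measure m M \<longleftrightarrow> sets M = sets borel \<and> emeasure M UNIV \<noteq> 0 \<and>
     (\<forall>K. compact K \<longrightarrow> emeasure M K < \<infinity>) \<and>
     (\<forall>a. \<forall>B\<in>sets borel. emeasure M (m a ` B) = emeasure M B)"

definition unimodular_group :: "('a::topological_space \<Rightarrow> 'a \<Rightarrow> 'a) \<Rightarrow> bool" where
  "unimodular_group m \<longleftrightarrow> (\<forall>M. left_haar_measure m M \<longrightarrow>
     (\<forall>a. \<forall>B\<in>sets borel. emeasure M ((\<lambda>x. m x a) ` B) = emeasure M B))"

definition lie_algebra ::
    "('a::topological_space, 'e::euclidean_space) atlas \<Rightarrow> ('a \<Rightarrow> 'a \<Rightarrow> 'a) \<Rightarrow> 'a vfield set" where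
  "lie_algebra A m = {X\<in>vector_fields A. \<forall>a b. X (m a b) = pushforward (m a) (X b)}"

definition left_invariant_metric ::
    "('a::topological_space, 'e::euclidean_space) atlas \<Rightarrow> ('a \<Rightarrow> 'a \<Rightarrow> 'a) \<Rightarrow> 'a tensor02 \<Rightarrow> bool" where
  "left_invariant_metric A m g \<longleftrightarrow>
     (\<forall>a b. \<forall>u\<in>tangent_space A b. \<forall>v\<in>tangent_space A b.
        g (m a b) (pushforward (m a) u) (pushforward (m a) v) = g b u v)"

definition left_invariant_tensor12 ::
    "('a::topological_space, 'e::euclidean_space) atlas \<Rightarrow> ('a \<Rightarrow> 'a \<Rightarrow> 'a) \<Rightarrow> 'a tensor12 \<Rightarrow> bool" where
  "left_invariant_tensor12 A m S \<longleftrightarrow>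
     (\<forall>a b. \<forall>u\<in>tangent_space A b. \<forall>v\<in>tangent_space A b.
        S (m a b) (pushforward (m a) u) (pushforward (m a) v) = pushforward (m a) (S b u v))"

definition cartan_schouten_minus ::
    "('a::topological_space, 'e::euclidean_space) atlas \<Rightarrow> ('a \<Rightarrow> 'a \<Rightarrow> 'a) \<Rightarrow> 'a connection" where
  "cartan_schouten_minus A m = (THE D. linear_connection A D \<and>
     (\<forall>X\<in>lie_algebra A m. \<forall>Y\<in>lie_algebra A m. D X Y = 0))"

definition basis_of_lie_algebra ::
    "('a::topological_space, 'e::euclidean_space) atlas \<Rightarrow> ('a \<Rightarrow> 'a \<Rightarrow> 'a) \<Rightarrow> 'a vfield set \<Rightarrow> bool" where
  "basis_of_lie_algebra A m B \<longleftrightarrow> independent B \<and> span B = lie_algebra A m"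

definition orthonormal_fields :: "'a tensor02 \<Rightarrow> 'a vfield set \<Rightarrow> bool" where
  "orthonormal_fields g B \<longleftrightarrow>
     (\<forall>X\<in>B. \<forall>Y\<in>B. ev g X Y = (if X = Y then (\<lambda>p. 1) else (\<lambda>p. 0)))"

end

theory Submission
  imports Defs
begin

text \<open>
  Let \<open>\<mu>\<^sub>i = (c\<^sub>j + c\<^sub>k - c\<^sub>i) / 2\<close>. In the frame, the Levi-Civita connection is
  \<open>\<nabla> X Y = X(Y) + (\<mu> X) \<times> Y\<close>, where \<open>X(Y)\<close> differentiates components, and its curvature has constant
  coefficients and is diagonal: it is given by the sectional curvatures
  \<open>K\<^sub>1 = \<mu>\<^sub>1 \<mu>\<^sub>2 + \<mu>\<^sub>1 \<mu>\<^sub>3 - \<mu>\<^sub>2 \<mu>\<^sub>3\<close> of the plane orthogonal to \<open>e\<^sub>1\<close>, and cyclically. The \<open>(-)\<close>-connection is \<open>X(Y)\<close> alone. It makes every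
  tensor with constant coefficients parallel, in particular \<open>g\<close>, the curvature and its own difference
  \<open>S X Y = - (\<mu> X) \<times> Y\<close> from \<open>\<nabla>\<close>; so this \<open>S\<close> is a homogeneous structure, and it is left invariant
  because its coefficients are constant.

  Conversely, let \<open>S\<close> be any homogeneous structure and \<open>D = \<nabla> + S\<close>. As \<open>D\<close> preserves the metric, its
  connection matrix in the frame is skew-symmetric and has three entries for each direction \<open>X\<close>.
  As \<open>D\<close> preserves the curvature, the entry that rotates \<open>e\<^sub>2\<close> into \<open>e\<^sub>3\<close> is annihilated by
  \<open>K\<^sub>2 - K\<^sub>3 = 2 \<mu>\<^sub>1 (c\<^sub>3 - c\<^sub>2)\<close> (lemma \<open>parallel_curvature_coefficient_0\<close>), and cyclically.
  Distinct \<open>c\<^sub>i\<close> have distinct \<open>\<mu>\<^sub>i\<close>, so at most one \<open>\<mu>\<^sub>i\<close> vanishes. If \<open>\<mu>\<^sub>1 = 0\<close>, the curvature leaves the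
  rotation about \<open>e\<^sub>1\<close> undetermined, but \<open>e\<^sub>1\<close> is then \<open>D\<close>-parallel and so is the operator
  \<open>V \<mapsto> S V e\<^sub>1 = - \<nabla> V e\<^sub>1\<close>, which is not invariant under rotations about \<open>e\<^sub>1\<close>
  (lemma \<open>homogeneous_structure_coefficient_0\<close>). Hence the frame is \<open>D\<close>-parallel, \<open>D\<close> is the
  \<open>(-)\<close>-connection, and \<open>S = D - \<nabla>\<close> is determined.

  The computations take place in the module of vector fields, which the frame makes free over the
  ring of smooth functions. Charts provide the ground for this: that smooth functions form a ring,
  that tangent vectors are derivations, and that tangent spaces are linear images of the
  coordinate space, hence at most three-dimensional and spanned by the frame.
\<close>

section \<open>Calculus of smooth functions on open sets\<close>

text \<open>Differentiability at a point of an open set only sees values nearby, so the iterated derivatives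
  of two functions that agree on the set agree there as well. The closure rules below need this
  because the product and sum rules identify derivatives on the set only.\<close>

lemma Ck_on_cong:
  assumes "open S" "\<And>x. x \<in> S \<Longrightarrow> f x = h x" "Ck_on k f S"
  shows "Ck_on k h S"
  using assms(2,3)
proof (induction k arbitrary: f h)
  case 0
  then show ?case by (simp cong: continuous_on_cong)
next
  case (Suc k)
  have der: "(h has_derivative frechet_derivative f (at x)) (at x)" if "x \<in> S" for x
  proof (rule has_derivative_transform_within_open[OF _ \<open>open S\<close> that])
    show "(f has_derivative frechet_derivative f (at x)) (at x)"
      using Suc.prems that frechet_derivative_works by auto
  qed (use Suc.prems in auto)
  then have "frechet_derivative h (at x) = frechet_derivative f (at x)" if "x \<in> S" for x
    using that frechet_derivative_at by metis
  moreover have "Ck_on k (\<lambda>x. frechet_derivative h (at x) v) S" for v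
    by (rule Suc.IH[of "\<lambda>x. frechet_derivative f (at x) v"]) (use calculation Suc.prems in auto)
  ultimately show ?case
    using der by (auto simp: differentiable_def)
qed

lemma Ck_on_Suc_imp_Ck_on: "Ck_on (Suc k) f S \<Longrightarrow> Ck_on k f S"
proof (induction k arbitrary: f)
  case 0
  then show ?case
    by (auto intro!: continuous_at_imp_continuous_on differentiable_imp_continuous_within)
next
  case (Suc k)
  then show ?case by auto
qed

lemma Ck_on_subset: "Ck_on k f S \<Longrightarrow> T \<subseteq> S \<Longrightarrow> Ck_on k f T"
  by (induction k arbitrary: f) (auto intro: continuous_on_subset)

lemma Ck_on_const: "Ck_on k (\<lambda>x. c) S"
  by (induction k arbitrary: c) auto

lemma Ck_on_add:
  assumes "open S" "Ck_on k f S" "Ck_on k h S"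
  shows "Ck_on k (\<lambda>x. f x + h x) S"
  using assms(2,3)
proof (induction k arbitrary: f h)
  case 0
  then show ?case by (auto intro: continuous_on_add)
next
  case (Suc k)
  have "Ck_on k (\<lambda>x. frechet_derivative f (at x) v + frechet_derivative h (at x) v) S" for v
    using Suc by auto
  moreover have add: "frechet_derivative (\<lambda>x. f x + h x) (at x) v =
      frechet_derivative f (at x) v + frechet_derivative h (at x) v" if "x \<in> S" for x v
  proof -
    have "((\<lambda>x. f x + h x) has_derivative
        (\<lambda>v. frechet_derivative f (at x) v + frechet_derivative h (at x) v)) (at x)"
      using Suc.prems that by (intro has_derivative_add) (auto simp: frechet_derivative_works[symmetric])
    then show ?thesis
      by (metis frechet_derivative_at)
  qed
  ultimately have "Ck_on k (\<lambda>x. frechet_derivative (\<lambda>x. f x + h x) (at x) v) S" for v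
    using Ck_on_cong[OF \<open>open S\<close>, of "\<lambda>x. frechet_derivative f (at x) v + frechet_derivative h (at x) v"
        "\<lambda>x. frechet_derivative (\<lambda>x. f x + h x) (at x) v" k] by simp
  with Suc.prems show ?case by auto
qed

lemma Ck_on_mult:
  fixes f h :: "'e::real_normed_vector \<Rightarrow> real"
  assumes "open S" "Ck_on k f S" "Ck_on k h S"
  shows "Ck_on k (\<lambda>x. f x * h x) S"
  using assms(2,3)
proof (induction k arbitrary: f h)
  case 0
  then show ?case by (auto intro: continuous_on_mult)
next
  case (Suc k)
  have "Ck_on k (\<lambda>x. f x * frechet_derivative h (at x) v + frechet_derivative f (at x) v * h x) S" for v
    using Suc.prems Suc.prems[THEN Ck_on_Suc_imp_Ck_on]
    by (intro Ck_on_add[OF \<open>open S\<close>] Suc.IH) simp_all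
  moreover have "frechet_derivative (\<lambda>x. f x * h x) (at x) v =
      f x * frechet_derivative h (at x) v + frechet_derivative f (at x) v * h x" if "x \<in> S" for x v
  proof -
    have "((\<lambda>x. f x * h x) has_derivative
        (\<lambda>v. f x * frechet_derivative h (at x) v + frechet_derivative f (at x) v * h x)) (at x)"
      using Suc.prems that by (intro has_derivative_mult) (auto simp: frechet_derivative_works[symmetric])
    then show ?thesis
      by (metis frechet_derivative_at)
  qed
  ultimately have "Ck_on k (\<lambda>x. frechet_derivative (\<lambda>x. f x * h x) (at x) v) S" for v
    using Ck_on_cong[OF \<open>open S\<close>, of "\<lambda>x. f x * frechet_derivative h (at x) v + frechet_derivative f (at x) v * h x"
        "\<lambda>x. frechet_derivative (\<lambda>x. f x * h x) (at x) v" k] by simp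
  with Suc.prems show ?case by auto
qed

text \<open>The chain rule for straight lines, which keeps the induction within one function at a time:
  the derivative of the composite in direction \<open>s\<close> is again the composite of a \<open>k\<close> times
  differentiable function, the derivative of \<open>f\<close> in direction \<open>s *\<^sub>R v\<close>, with the same line.\<close>

lemma Ck_on_compose_line:
  fixes f :: "'e::real_normed_vector \<Rightarrow> 'f::real_normed_vector" and x0 v :: 'e
  assumes "open S" "Ck_on k f S"
  shows "Ck_on k (\<lambda>t::real. f (x0 + t *\<^sub>R v)) ((\<lambda>t. x0 + t *\<^sub>R v) -` S)"
  using assms(2)
proof (induction k arbitrary: f)
  case 0
  then show ?case
    by (auto intro!: continuous_on_compose2[of S f] continuous_intros)
next
  case (Suc k)
  let ?l = "\<lambda>t. x0 + t *\<^sub>R v"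
  have opn: "open (?l -` S)"
    by (intro open_vimage \<open>open S\<close> continuous_intros)
  have der: "((\<lambda>t. f (?l t)) has_derivative (\<lambda>s. frechet_derivative f (at (?l t)) (s *\<^sub>R v))) (at t)"
    if "t \<in> ?l -` S" for t
  proof -
    have "(f has_derivative frechet_derivative f (at (?l t))) (at (?l t))"
      using Suc.prems that by (auto simp: frechet_derivative_works[symmetric])
    moreover have "(?l has_derivative (\<lambda>s. s *\<^sub>R v)) (at t)"
      by (auto intro!: derivative_eq_intros)
    ultimately show ?thesis
      by (rule has_derivative_compose[rotated])
  qed
  have "Ck_on k (\<lambda>t. frechet_derivative (\<lambda>t. f (?l t)) (at t) s) (?l -` S)" for s
  proof (rule Ck_on_cong[OF opn])
    show "Ck_on k (\<lambda>t. frechet_derivative f (at (?l t)) (s *\<^sub>R v)) (?l -` S)"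
      using Suc.IH[of "\<lambda>x. frechet_derivative f (at x) (s *\<^sub>R v)"] Suc.prems by simp
    show "frechet_derivative f (at (?l t)) (s *\<^sub>R v) = frechet_derivative (\<lambda>t. f (?l t)) (at t) s"
      if "t \<in> ?l -` S" for t
      using frechet_derivative_at[OF der[OF that]] by metis
  qed
  with der show ?case
    by (auto simp: differentiable_def)
qed

lemma smooth_on_imp_differentiable: "smooth_on S f \<Longrightarrow> x \<in> S \<Longrightarrow> f differentiable (at x)"
  unfolding smooth_on_def by (metis Ck_on.simps(2))

section \<open>Smooth functions on a manifold\<close>

lemma smooth_atlasD:
  assumes "smooth_atlas A" "(U, \<phi>) \<in> A"
  shows "open U" "open (\<phi> ` U)" "homeomorphism U (\<phi> ` U) \<phi> (inv_into U \<phi>)"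
  using assms unfolding smooth_atlas_def by auto

lemma smooth_atlas_chart:
  assumes "smooth_atlas A"
  obtains U \<phi> where "(U, \<phi>) \<in> A" "p \<in> U"
proof -
  have "p \<in> (\<Union>(U, \<phi>)\<in>A. U)" using assms unfolding smooth_atlas_def by auto
  then show thesis using that by auto
qed

text \<open>The target chart of the real line is the identity, so smoothness is smoothness of the
  coordinate expressions.\<close>

lemma smooth_functions_iff:
  "f \<in> smooth_functions A \<longleftrightarrow>
     continuous_on UNIV f \<and> (\<forall>(U, \<phi>)\<in>A. smooth_on (\<phi> ` U) (f \<circ> inv_into U \<phi>))"
  unfolding smooth_functions_def smooth_map_on_def real_atlas_def by auto

lemma smooth_functions_const: "(\<lambda>_. c) \<in> smooth_functions A"
  unfolding smooth_functions_iff smooth_on_def by (auto simp: o_def Ck_on_const)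

lemma smooth_functions_add:
  assumes "smooth_atlas A" "f \<in> smooth_functions A" "h \<in> smooth_functions A"
  shows "f + h \<in> smooth_functions A"
  using assms smooth_atlasD(2)[OF assms(1)] unfolding smooth_functions_iff smooth_on_def
  by (auto simp: o_def plus_fun_def intro!: continuous_on_add Ck_on_add)

lemma smooth_functions_mult:
  assumes "smooth_atlas A" "f \<in> smooth_functions A" "h \<in> smooth_functions A"
  shows "f * h \<in> smooth_functions A"
  using assms smooth_atlasD(2)[OF assms(1)] unfolding smooth_functions_iff smooth_on_def
  by (auto simp: o_def times_fun_def intro!: continuous_on_mult Ck_on_mult)

lemma smooth_functions_uminus:
  assumes "smooth_atlas A" "f \<in> smooth_functions A"
  shows "- f \<in> smooth_functions A"
  using smooth_functions_mult[OF assms(1) smooth_functions_const[of "-1"] assms(2)]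
  by (simp add: times_fun_def fun_Compl_def)

lemma smooth_functions_diff:
  assumes "smooth_atlas A" "f \<in> smooth_functions A" "h \<in> smooth_functions A"
  shows "f - h \<in> smooth_functions A"
  using smooth_functions_add[OF assms(1,2) smooth_functions_uminus[OF assms(1,3)]] by simp

section \<open>Tangent spaces in a chart\<close>

text \<open>The tangent vector with coordinates \<open>v\<close> in a chart: the derivative in direction \<open>v\<close> of the
  coordinate expression. Sums of velocities of curves are not evidently velocities of curves, but this
  expression is visibly linear in \<open>v\<close>; it yields the linear structure and the dimension of the
  tangent spaces.\<close>

definition chart_tvec ::
    "('a::topological_space, 'e::euclidean_space) atlas \<Rightarrow> 'a set \<Rightarrow> ('a \<Rightarrow> 'e) \<Rightarrow> 'a \<Rightarrow> 'e \<Rightarrow> 'a tvec" where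
  "chart_tvec A U \<phi> p v =
     (\<lambda>f. if f \<in> smooth_functions A
          then frechet_derivative (f \<circ> inv_into U \<phi>) (at (\<phi> p)) v else 0)"

lemma smooth_function_has_chart_derivative:
  assumes "smooth_atlas A" "(U, \<phi>) \<in> A" "p \<in> U" "f \<in> smooth_functions A"
  shows "((f \<circ> inv_into U \<phi>) has_derivative frechet_derivative (f \<circ> inv_into U \<phi>) (at (\<phi> p)))
           (at (\<phi> p))"
proof -
  have "smooth_on (\<phi> ` U) (f \<circ> inv_into U \<phi>)"
    using assms(2,4) unfolding smooth_functions_iff by auto
  then show ?thesis
    using assms(3) smooth_on_imp_differentiable frechet_derivative_works by blast
qed

text \<open>The chain rule for the coordinate expressions of the function and of the curve.\<close>

lemma velocity_eq_chart_tvec: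
  assumes "smooth_atlas A" "(U, \<phi>) \<in> A" "\<gamma> 0 \<in> U" "\<epsilon> > 0"
    and smooth: "smooth_map_on real_atlas A {-\<epsilon><..<\<epsilon>} \<gamma>"
  shows "velocity A \<gamma> = chart_tvec A U \<phi> (\<gamma> 0) (vector_derivative (\<phi> \<circ> \<gamma>) (at 0))"
proof -
  let ?W = "{-\<epsilon><..<\<epsilon>} \<inter> \<gamma> -` U" and ?p = "\<gamma> 0"
  have cont: "continuous_on {-\<epsilon><..<\<epsilon>} \<gamma>" and sm: "smooth_on ?W (\<phi> \<circ> \<gamma>)"
    using smooth assms(2) unfolding smooth_map_on_def real_atlas_def by fastforce+
  have W: "open ?W" "0 \<in> ?W"
    using continuous_open_preimage[OF cont _ smooth_atlasD(1)[OF assms(1,2)]] assms by auto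
  have der: "((\<phi> \<circ> \<gamma>) has_derivative (\<lambda>s. s *\<^sub>R vector_derivative (\<phi> \<circ> \<gamma>) (at 0))) (at 0)"
    using smooth_on_imp_differentiable[OF sm W(2)]
    by (metis has_vector_derivative_def vector_derivative_works)
  have inv: "inv_into U \<phi> (\<phi> q) = q" if "q \<in> U" for q
    using smooth_atlasD(3)[OF assms(1,2)] that unfolding homeomorphism_def by blast
  have "deriv (\<lambda>t. f (\<gamma> t)) 0 =
      frechet_derivative (f \<circ> inv_into U \<phi>) (at (\<phi> ?p)) (vector_derivative (\<phi> \<circ> \<gamma>) (at 0))"
    if f: "f \<in> smooth_functions A" for f
  proof -
    note fd = smooth_function_has_chart_derivative[OF assms(1-3) f]
    let ?D = "frechet_derivative (f \<circ> inv_into U \<phi>) (at (\<phi> ?p))"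
    have "((\<lambda>t. (f \<circ> inv_into U \<phi>) ((\<phi> \<circ> \<gamma>) t)) has_derivative
        (\<lambda>s. ?D (s *\<^sub>R vector_derivative (\<phi> \<circ> \<gamma>) (at 0)))) (at 0)"
      by (rule has_derivative_compose[OF der]) (use fd in \<open>unfold o_apply[of \<phi> \<gamma> 0]\<close>)
    then have "((\<lambda>t. f (\<gamma> t)) has_derivative
        (\<lambda>s. ?D (s *\<^sub>R vector_derivative (\<phi> \<circ> \<gamma>) (at 0)))) (at 0)"
      by (rule has_derivative_transform_within_open[OF _ W]) (use inv in auto)
    then have "((\<lambda>t. f (\<gamma> t)) has_field_derivative ?D (vector_derivative (\<phi> \<circ> \<gamma>) (at 0))) (at 0)"
      unfolding has_field_derivative_def
      by (simp add: linear_cmul[OF has_derivative_linear[OF fd]] mult_commute_abs)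
    then show ?thesis by (rule DERIV_imp_deriv)
  qed
  then show ?thesis unfolding velocity_def chart_tvec_def by auto
qed

text \<open>Every coordinate vector is the velocity of a smooth curve, namely of a short coordinate line.
  Its smoothness in the other charts is smoothness of the transition maps along a line.\<close>

lemma chart_line_smooth:
  assumes "smooth_atlas A" "(U, \<phi>) \<in> A" "p \<in> U"
  obtains \<epsilon> where "\<epsilon> > 0" "smooth_map_on real_atlas A {-\<epsilon><..<\<epsilon>} (\<lambda>t. inv_into U \<phi> (\<phi> p + t *\<^sub>R v))"
    "\<And>t. t \<in> {-\<epsilon><..<\<epsilon>} \<Longrightarrow> \<phi> p + t *\<^sub>R v \<in> \<phi> ` U"
proof -
  let ?l = "\<lambda>t. \<phi> p + t *\<^sub>R v" and ?\<gamma> = "\<lambda>t. inv_into U \<phi> (\<phi> p + t *\<^sub>R v)"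
  note hom = smooth_atlasD(3)[OF assms(1,2)]
  have "open (?l -` (\<phi> ` U))"
    by (intro open_vimage smooth_atlasD(2)[OF assms(1,2)] continuous_intros)
  moreover have "0 \<in> ?l -` (\<phi> ` U)" using assms(3) by auto
  ultimately obtain \<epsilon> where \<epsilon>: "\<epsilon> > 0" "ball 0 \<epsilon> \<subseteq> ?l -` (\<phi> ` U)"
    using open_contains_ball by metis
  have l: "?l t \<in> \<phi> ` U" if "t \<in> {-\<epsilon><..<\<epsilon>}" for t
    using \<epsilon>(2) that by (auto simp: subset_iff)
  have "continuous_on {-\<epsilon><..<\<epsilon>} ?\<gamma>"
    by (rule continuous_on_compose2[of "\<phi> ` U" "inv_into U \<phi>"])
       (use hom l in \<open>auto simp: homeomorphism_def intro!: continuous_intros\<close>)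
  moreover have "smooth_on ({-\<epsilon><..<\<epsilon>} \<inter> ?\<gamma> -` V) (\<lambda>t. \<psi> (?\<gamma> t))" if V: "(V, \<psi>) \<in> A" for V \<psi>
  proof -
    have sm: "smooth_on (\<phi> ` (U \<inter> V)) (\<psi> \<circ> inv_into U \<phi>)"
      using assms(1,2) V unfolding smooth_atlas_def by fastforce
    have eq: "\<phi> ` (U \<inter> V) = \<phi> ` U \<inter> inv_into U \<phi> -` V"
      using hom unfolding homeomorphism_def by force
    have opn: "open (\<phi> ` (U \<inter> V))"
      unfolding eq using hom smooth_atlasD[OF assms(1,2)] smooth_atlasD(1)[OF assms(1) V]
      by (intro continuous_open_preimage) (auto simp: homeomorphism_def)
    have "{-\<epsilon><..<\<epsilon>} \<inter> ?\<gamma> -` V \<subseteq> ?l -` (\<phi> ` (U \<inter> V))"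
      unfolding eq using l by auto
    then show ?thesis
      using sm Ck_on_compose_line[OF opn, of _ "\<psi> \<circ> inv_into U \<phi>" "\<phi> p" v]
      unfolding smooth_on_def o_def by (blast intro: Ck_on_subset)
  qed
  ultimately have "smooth_map_on real_atlas A {-\<epsilon><..<\<epsilon>} ?\<gamma>"
    unfolding smooth_map_on_def real_atlas_def by (auto simp: o_def)
  with \<epsilon>(1) l show thesis using that by blast
qed

lemma tangent_space_eq_range_chart_tvec:
  assumes "smooth_atlas A" "(U, \<phi>) \<in> A" "p \<in> U"
  shows "tangent_space A p = range (chart_tvec A U \<phi> p)"
proof (intro equalityI subsetI)
  fix w assume "w \<in> tangent_space A p"
  then show "w \<in> range (chart_tvec A U \<phi> p)"
    unfolding tangent_space_def using velocity_eq_chart_tvec[OF assms(1,2)] assms(3) by fastforce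
next
  fix w assume "w \<in> range (chart_tvec A U \<phi> p)"
  then obtain v where w: "w = chart_tvec A U \<phi> p v" by auto
  let ?\<gamma> = "\<lambda>t. inv_into U \<phi> (\<phi> p + t *\<^sub>R v)"
  obtain \<epsilon> where \<epsilon>: "\<epsilon> > 0" "smooth_map_on real_atlas A {-\<epsilon><..<\<epsilon>} ?\<gamma>"
    "\<And>t. t \<in> {-\<epsilon><..<\<epsilon>} \<Longrightarrow> \<phi> p + t *\<^sub>R v \<in> \<phi> ` U"
    using chart_line_smooth[OF assms] by blast
  have p: "?\<gamma> 0 = p"
    using smooth_atlasD(3)[OF assms(1,2)] assms(3) by (simp add: homeomorphism_def)
  have "((\<lambda>t. \<phi> p + t *\<^sub>R v) has_vector_derivative v) (at 0)"
    by (auto intro!: derivative_eq_intros)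
  then have "((\<phi> \<circ> ?\<gamma>) has_vector_derivative v) (at 0)"
    by (rule has_vector_derivative_transform_within_open[of _ _ _ "{-\<epsilon><..<\<epsilon>}"])
       (use \<epsilon> in \<open>auto simp: f_inv_into_f\<close>)
  then have "vector_derivative (\<phi> \<circ> ?\<gamma>) (at 0) = v"
    by (rule vector_derivative_at)
  then have "w = velocity A ?\<gamma>"
    using velocity_eq_chart_tvec[OF assms(1,2) _ \<epsilon>(1,2)] assms(3) p w by simp
  then show "w \<in> tangent_space A p"
    unfolding tangent_space_def using \<epsilon>(1,2) p by blast
qed

lemma linear_chart_tvec:
  assumes "smooth_atlas A" "(U, \<phi>) \<in> A" "p \<in> U"
  shows "linear (chart_tvec A U \<phi> p)"
  using has_derivative_linear[OF smooth_function_has_chart_derivative[OF assms]]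
  by (intro linearI) (auto simp: chart_tvec_def fun_eq_iff scaleR_fun_def linear_add linear_cmul)

lemma subspace_tangent_space:
  assumes "smooth_atlas A"
  shows "subspace (tangent_space A p)"
  using smooth_atlas_chart[OF assms, of p] tangent_space_eq_range_chart_tvec[OF assms]
    linear_chart_tvec[OF assms] linear_subspace_image subspace_UNIV by metis

text \<open>A tangent space is spanned by the images of the standard basis vectors under a chart, so an
  exchange argument bounds the size of independent sets.\<close>

lemma independent_spans_tangent_space:
  fixes A :: "('a::{t2_space,second_countable_topology}, 'e::euclidean_space) atlas"
  assumes "smooth_atlas A" "B \<subseteq> tangent_space A p" "independent B" "card B = DIM('e)"
  shows "tangent_space A p \<subseteq> span B"
proof
  fix w assume w: "w \<in> tangent_space A p"
  obtain U \<phi> where U: "(U, \<phi>) \<in> A" "p \<in> U"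
    using smooth_atlas_chart[OF assms(1)] by blast
  let ?L = "chart_tvec A U \<phi> p"
  have T: "tangent_space A p = span (?L ` Basis)"
    unfolding tangent_space_eq_range_chart_tvec[OF assms(1) U]
    using linear_span_image[OF linear_chart_tvec[OF assms(1) U], of Basis] by simp
  show "w \<in> span B"
  proof (rule ccontr)
    assume "w \<notin> span B"
    then have "independent (insert w B)" "w \<notin> B"
      using assms(3) by (auto simp: independent_insert span_base)
    moreover have "finite B" using assms(4) DIM_positive[where 'a='e] card.infinite by force
    moreover have "insert w B \<subseteq> span (?L ` Basis)" using w assms(2) T by auto
    then have "card (insert w B) \<le> card (?L ` Basis)"
      using independent_span_bound[OF _ calculation(1)] by auto
    moreover have "card (?L ` Basis) \<le> DIM('e)" by (simp add: card_image_le)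
    ultimately show False using assms(4) by simp
  qed
qed

lemma tangent_vector_nonsmooth:
  assumes "w \<in> tangent_space A p" "f \<notin> smooth_functions A"
  shows "w f = 0"
  using assms unfolding tangent_space_def velocity_def by auto

lemma tangent_vector_derivation:
  assumes "smooth_atlas A" "w \<in> tangent_space A p" "f \<in> smooth_functions A" "h \<in> smooth_functions A"
  shows "w (f + h) = w f + w h"
    and "w (f * h) = f p * w h + w f * h p"
    and "w (\<lambda>_. c) = 0"
proof -
  obtain U \<phi> where U: "(U, \<phi>) \<in> A" "p \<in> U"
    using smooth_atlas_chart[OF assms(1)] by blast
  obtain v where v: "w = chart_tvec A U \<phi> p v"
    using assms(2) tangent_space_eq_range_chart_tvec[OF assms(1) U] by auto
  have p: "inv_into U \<phi> (\<phi> p) = p"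
    using smooth_atlasD(3)[OF assms(1) U(1)] U(2) by (simp add: homeomorphism_def)
  let ?D = "\<lambda>f. frechet_derivative (f \<circ> inv_into U \<phi>) (at (\<phi> p))"
  note fd = smooth_function_has_chart_derivative[OF assms(1) U assms(3)]
    and hd = smooth_function_has_chart_derivative[OF assms(1) U assms(4)]
  have "?D (f + h) = (\<lambda>v. ?D f v + ?D h v)"
    using has_derivative_add[OF fd hd] by (intro frechet_derivative_at[symmetric]) (simp add: o_def plus_fun_def)
  then show "w (f + h) = w f + w h"
    using assms v smooth_functions_add by (auto simp: chart_tvec_def)
  have "?D (f * h) = (\<lambda>v. f p * ?D h v + ?D f v * h p)"
    using has_derivative_mult[OF fd hd] p by (intro frechet_derivative_at[symmetric]) (simp add: o_def times_fun_def)
  then show "w (f * h) = f p * w h + w f * h p"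
    using assms v smooth_functions_mult by (auto simp: chart_tvec_def)
  show "w (\<lambda>_. c) = 0"
    using v by (auto simp: chart_tvec_def o_def)
qed

section \<open>The module of vector fields\<close>

lemma vector_fieldD: "X \<in> vector_fields A \<Longrightarrow> X p \<in> tangent_space A p"
  by (simp add: vector_fields_def)

lemma deriv_along_smooth:
  "X \<in> vector_fields A \<Longrightarrow> f \<in> smooth_functions A \<Longrightarrow> deriv_along X f \<in> smooth_functions A"
  by (simp add: vector_fields_def)

lemma vector_fields_add:
  assumes "smooth_atlas A" "X \<in> vector_fields A" "Y \<in> vector_fields A"
  shows "X + Y \<in> vector_fields A"
proof -
  have "deriv_along (X + Y) f = deriv_along X f + deriv_along Y f" for f
    by (auto simp: deriv_along_def)
  with assms show ?thesis
    by (simp add: vector_fields_def smooth_functions_add subspace_add[OF subspace_tangent_space])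
qed

lemma vector_fields_fmul:
  assumes "smooth_atlas A" "h \<in> smooth_functions A" "X \<in> vector_fields A"
  shows "fmul h X \<in> vector_fields A"
proof -
  have "deriv_along (fmul h X) f = h * deriv_along X f" for f
    by (auto simp: deriv_along_def fmul_def scaleR_fun_def)
  moreover have "fmul h X p \<in> tangent_space A p" for p
    using assms by (simp add: vector_fields_def fmul_def subspace_scale[OF subspace_tangent_space])
  ultimately show ?thesis
    using assms by (simp add: vector_fields_def smooth_functions_mult)
qed

text \<open>Constants as elements of the ring of functions. Keeping them folded lets the simplifier treat
  computations with vector fields as polynomial identities over that ring.\<close>

definition const_fun :: "real \<Rightarrow> 'a \<Rightarrow> real" where
  "const_fun c = (\<lambda>_. c)"

lemma const_fun_smooth [simp]: "const_fun c \<in> smooth_functions A"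
  unfolding const_fun_def by (rule smooth_functions_const)

lemma const_fun_0 [simp]: "const_fun 0 = 0" and const_fun_1 [simp]: "const_fun 1 = 1"
  by (auto simp: const_fun_def)

lemma scaleR_eq_fmul: "c *\<^sub>R X = fmul (const_fun c) X"
  by (auto simp: fmul_def const_fun_def scaleR_fun_def)

lemma smooth_functions_0_1:
  "0 \<in> smooth_functions A" "1 \<in> smooth_functions A"
  using const_fun_smooth[of 0] const_fun_smooth[of 1] by simp_all

lemma vector_fields_diff:
  assumes "smooth_atlas A" "X \<in> vector_fields A" "Y \<in> vector_fields A"
  shows "X - Y \<in> vector_fields A"
proof -
  have "X - Y = X + fmul (const_fun (-1)) Y"
    by (auto simp: scaleR_eq_fmul[symmetric] fun_eq_iff scaleR_fun_def)
  then show ?thesis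
    using vector_fields_add[OF assms(1,2) vector_fields_fmul[OF assms(1) const_fun_smooth assms(3)]]
    by metis
qed

lemma vector_fields_0:
  assumes "smooth_atlas A" "X \<in> vector_fields A"
  shows "0 \<in> vector_fields A"
  using vector_fields_diff[OF assms assms(2)] by simp

lemma deriv_along_add:
  assumes "smooth_atlas A" "X \<in> vector_fields A" "f \<in> smooth_functions A" "h \<in> smooth_functions A"
  shows "deriv_along X (f + h) = deriv_along X f + deriv_along X h"
  using tangent_vector_derivation(1)[OF assms(1) vector_fieldD[OF assms(2)] assms(3,4)]
  by (auto simp: deriv_along_def)

lemma deriv_along_mult:
  assumes "smooth_atlas A" "X \<in> vector_fields A" "f \<in> smooth_functions A" "h \<in> smooth_functions A"
  shows "deriv_along X (f * h) = f * deriv_along X h + deriv_along X f * h"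
  using tangent_vector_derivation(2)[OF assms(1) vector_fieldD[OF assms(2)] assms(3,4)]
  by (auto simp: deriv_along_def)

lemma deriv_along_const:
  assumes "smooth_atlas A" "X \<in> vector_fields A"
  shows "deriv_along X (const_fun c) = 0"
  using tangent_vector_derivation(3)[OF assms(1) vector_fieldD[OF assms(2)]
      smooth_functions_0_1(1) smooth_functions_0_1(1)]
  by (auto simp: deriv_along_def const_fun_def)

lemma deriv_along_uminus:
  assumes "smooth_atlas A" "X \<in> vector_fields A" "f \<in> smooth_functions A"
  shows "deriv_along X (- f) = - deriv_along X f"
  using deriv_along_add[OF assms smooth_functions_uminus[OF assms(1,3)]]
    deriv_along_const[OF assms(1,2), of 0]
  by (simp add: eq_neg_iff_add_eq_0 add.commute)

lemma deriv_along_diff: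
  assumes "smooth_atlas A" "X \<in> vector_fields A" "f \<in> smooth_functions A" "h \<in> smooth_functions A"
  shows "deriv_along X (f - h) = deriv_along X f - deriv_along X h"
  using deriv_along_add[OF assms(1-3) smooth_functions_uminus[OF assms(1,4)]]
    deriv_along_uminus[OF assms(1,2,4)] by simp

lemma deriv_along_nonsmooth:
  "X \<in> vector_fields A \<Longrightarrow> f \<notin> smooth_functions A \<Longrightarrow> deriv_along X f = 0"
  by (simp add: deriv_along_def fun_eq_iff tangent_vector_nonsmooth[OF vector_fieldD])

lemma deriv_along_combine:
  "deriv_along (X + Y) f = deriv_along X f + deriv_along Y f"
  "deriv_along (fmul h X) f = h * deriv_along X f"
  by (auto simp: deriv_along_def fmul_def scaleR_fun_def)

lemma deriv_along_bracket:
  "deriv_along (bracket X Y) f = deriv_along X (deriv_along Y f) - deriv_along Y (deriv_along X f)"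
  by (auto simp: deriv_along_def bracket_def)

lemma vector_fields_eqI:
  assumes "\<And>f. deriv_along X f = deriv_along Y f"
  shows "X = Y"
  using assms by (auto simp: deriv_along_def fun_eq_iff)

lemma const_fun_ring:
  "const_fun (a + b) = const_fun a + const_fun b"
  "const_fun (a - b) = const_fun a - const_fun b"
  "const_fun (- a) = - const_fun a"
  "const_fun (a * b) = const_fun a * const_fun b"
  by (auto simp: const_fun_def)

lemma const_fun_mult_eq_0:
  assumes "const_fun a * f = 0" "a \<noteq> 0"
  shows "f = 0"
  using assms by (simp add: const_fun_def fun_eq_iff)

lemma fmul_zero [simp]: "fmul h 0 = 0" "fmul 0 X = 0"
  by (auto simp: fmul_def scaleR_fun_def fun_eq_iff)

lemma fmul_add: "fmul h (X + Y) = fmul h X + fmul h Y"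
  by (rule ext) (simp add: fmul_def scaleR_add_right)

section \<open>Linear connections and tensor fields\<close>

lemma linear_connection_closed:
  "linear_connection A D \<Longrightarrow> X \<in> vector_fields A \<Longrightarrow> Y \<in> vector_fields A \<Longrightarrow> D X Y \<in> vector_fields A"
  by (simp add: linear_connection_def)

lemma linear_connection_default:
  "linear_connection A D \<Longrightarrow> \<not> (X \<in> vector_fields A \<and> Y \<in> vector_fields A) \<Longrightarrow> D X Y = 0"
  unfolding linear_connection_def by blast

lemma linear_connection_add:
  assumes "linear_connection A D" "X \<in> vector_fields A" "Y \<in> vector_fields A" "Z \<in> vector_fields A"
  shows "D (X + Y) Z = D X Z + D Y Z" "D X (Y + Z) = D X Y + D X Z"
  using assms by (simp_all add: linear_connection_def)

lemma linear_connection_fmul: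
  assumes "linear_connection A D" "X \<in> vector_fields A" "Y \<in> vector_fields A" "h \<in> smooth_functions A"
  shows "D (fmul h X) Y = fmul h (D X Y)"
    "D X (fmul h Y) = fmul (deriv_along X h) Y + fmul h (D X Y)"
  using assms by (simp_all add: linear_connection_def)

lemma tensor_ev_closed:
  "tensor_field12 A S \<Longrightarrow> X \<in> vector_fields A \<Longrightarrow> Y \<in> vector_fields A \<Longrightarrow> ev S X Y \<in> vector_fields A"
  by (simp add: tensor_field12_def)

lemma tensor_bilinear:
  assumes S: "tensor_field12 A S" and u: "u \<in> tangent_space A p" "v \<in> tangent_space A p" "w \<in> tangent_space A p"
  shows "S p (u + v) w = S p u w + S p v w" "S p w (u + v) = S p w u + S p w v"
    "S p (r *\<^sub>R u) w = r *\<^sub>R S p u w" "S p w (r *\<^sub>R u) = r *\<^sub>R S p w u"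
proof -
  have b: "S p (r *\<^sub>R u + s *\<^sub>R v) w = r *\<^sub>R S p u w + s *\<^sub>R S p v w"
      "S p w (r *\<^sub>R u + s *\<^sub>R v) = r *\<^sub>R S p w u + s *\<^sub>R S p w v" for r s
    using S u by (simp_all add: tensor_field12_def bilinear_at_def)
  show "S p (u + v) w = S p u w + S p v w" "S p w (u + v) = S p w u + S p w v"
    "S p (r *\<^sub>R u) w = r *\<^sub>R S p u w" "S p w (r *\<^sub>R u) = r *\<^sub>R S p w u"
    using b[of 1 1] b[of r 0] by simp_all
qed

lemma tensor_ev_add:
  assumes S: "tensor_field12 A S"
    and X: "X \<in> vector_fields A" and Y: "Y \<in> vector_fields A" and Z: "Z \<in> vector_fields A"
  shows "ev S (X + Y) Z = ev S X Z + ev S Y Z" "ev S Z (X + Y) = ev S Z X + ev S Z Y"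
  by (rule ext, simp add: ev_def tensor_bilinear(1,2)[OF S vector_fieldD[OF X] vector_fieldD[OF Y] vector_fieldD[OF Z]])+

lemma tensor_ev_fmul:
  assumes S: "tensor_field12 A S" and X: "X \<in> vector_fields A" and Y: "Y \<in> vector_fields A"
  shows "ev S (fmul h X) Y = fmul h (ev S X Y)" "ev S Y (fmul h X) = fmul h (ev S Y X)"
  by (rule ext, simp add: ev_def fmul_def tensor_bilinear(3,4)[OF S vector_fieldD[OF X] vector_fieldD[OF X] vector_fieldD[OF Y]])+

section \<open>Orthonormal frames with diagonal structure constants\<close>

text \<open>Milnor's constants \<open>\<mu>\<^sub>i = (c\<^sub>j + c\<^sub>k - c\<^sub>i) / 2\<close>; the Levi-Civita connection is
  \<open>\<nabla> e\<^sub>i e\<^sub>j = \<mu>\<^sub>i e\<^sub>k\<close> for cyclic \<open>(i, j, k)\<close>.\<close>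

definition milnor_const :: "real \<Rightarrow> real \<Rightarrow> real \<Rightarrow> real" where
  "milnor_const c1 c2 c3 = (c2 + c3 - c1) / 2"

definition frame_comb ::
    "'a vfield \<Rightarrow> 'a vfield \<Rightarrow> 'a vfield \<Rightarrow> ('a \<Rightarrow> real) \<Rightarrow> ('a \<Rightarrow> real) \<Rightarrow> ('a \<Rightarrow> real) \<Rightarrow> 'a vfield" where
  "frame_comb e1 e2 e3 x1 x2 x3 = fmul x1 e1 + fmul x2 e2 + fmul x3 e3"

text \<open>With Milnor's constants as arguments this is the sectional curvature of the coordinate plane
  orthogonal to \<open>e\<^sub>1\<close>; the other two planes are obtained by rotating the arguments.\<close>

definition sect_const :: "real \<Rightarrow> real \<Rightarrow> real \<Rightarrow> real" where
  "sect_const a b c = a * b + a * c - b * c"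

lemma function_double_eq_0:
  fixes f :: "'a \<Rightarrow> real"
  assumes "f = - f"
  shows "f = 0"
  using assms by (simp add: fun_eq_iff)

lemma diff_diff_diff_eq_0:
  fixes a b c :: "'b::ab_group_add"
  assumes "0 - a - b - c = 0"
  shows "a + b + c = 0"
proof -
  have "a + b + c = 0 - (0 - a - b - c)" by simp
  then show ?thesis unfolding assms by simp
qed

lemma frame_combination_linear:
  fixes a1 a2 a3 b1 b2 b3 r s :: real and x1 x2 x3 :: "'v::real_vector"
  shows "(r * a1 + s * b1) *\<^sub>R x1 + (r * a2 + s * b2) *\<^sub>R x2 + (r * a3 + s * b3) *\<^sub>R x3 =
    r *\<^sub>R (a1 *\<^sub>R x1 + a2 *\<^sub>R x2 + a3 *\<^sub>R x3) + s *\<^sub>R (b1 *\<^sub>R x1 + b2 *\<^sub>R x2 + b3 *\<^sub>R x3)"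
  by (simp add: algebra_simps)

text \<open>A unimodular basis of left invariant vector fields, regarded as a global orthonormal frame of
  the manifold.\<close>

locale unimodular_frame =
  fixes A :: "('a::{t2_space,second_countable_topology}, real^3) atlas"
    and g :: "'a tensor02" and e1 e2 e3 :: "'a vfield" and c1 c2 c3 :: real
  assumes atlas: "smooth_atlas A"
    and metric: "riemannian_metric A g"
    and e_fields [simp]: "e1 \<in> vector_fields A" "e2 \<in> vector_fields A" "e3 \<in> vector_fields A"
    and e_orthonormal: "orthonormal_fields g {e1, e2, e3}"
    and e_distinct: "distinct [e1, e2, e3]"
    and bracket12: "bracket e1 e2 = fmul (const_fun c3) e3"
    and bracket23: "bracket e2 e3 = fmul (const_fun c1) e1"
    and bracket31: "bracket e3 e1 = fmul (const_fun c2) e2"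
begin

text \<open>The hypotheses are invariant under cyclic relabelling of the frame. Each computation below is
  therefore made for one component, and the other two follow by rotation.\<close>

lemma rotate: "unimodular_frame A g e2 e3 e1 c2 c3 c1"
  using atlas metric e_fields e_orthonormal e_distinct bracket12 bracket23 bracket31
  by unfold_locales (auto simp: insert_commute)

abbreviation comp1 :: "'a vfield \<Rightarrow> 'a \<Rightarrow> real" where "comp1 X \<equiv> ev g X e1"
abbreviation comp2 :: "'a vfield \<Rightarrow> 'a \<Rightarrow> real" where "comp2 X \<equiv> ev g X e2"
abbreviation comp3 :: "'a vfield \<Rightarrow> 'a \<Rightarrow> real" where "comp3 X \<equiv> ev g X e3"
abbreviation comb where "comb \<equiv> frame_comb e1 e2 e3"
abbreviation "VF \<equiv> vector_fields A"
abbreviation "C \<equiv> smooth_functions A"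

lemmas smooth_closed [simp] =
  smooth_functions_0_1 smooth_functions_add[OF atlas] smooth_functions_mult[OF atlas]
  smooth_functions_diff[OF atlas] smooth_functions_uminus[OF atlas] deriv_along_smooth

lemmas fields_closed [simp] =
  vector_fields_add[OF atlas] vector_fields_diff[OF atlas] vector_fields_fmul[OF atlas]
  vector_fields_0[OF atlas e_fields(1)]

lemmas derivation [simp] =
  deriv_along_const[OF atlas] deriv_along_add[OF atlas] deriv_along_mult[OF atlas]
  deriv_along_uminus[OF atlas] deriv_along_diff[OF atlas]

lemma derivation_0_1 [simp]:
  "X \<in> VF \<Longrightarrow> deriv_along X 0 = 0" "X \<in> VF \<Longrightarrow> deriv_along X 1 = 0"
  using derivation(1)[of X 0] derivation(1)[of X 1] by simp_all

lemma comb_closed [simp]: "x1 \<in> C \<Longrightarrow> x2 \<in> C \<Longrightarrow> x3 \<in> C \<Longrightarrow> comb x1 x2 x3 \<in> VF"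
  by (simp add: frame_comb_def)

lemma g_smooth [simp]: "X \<in> VF \<Longrightarrow> Y \<in> VF \<Longrightarrow> ev g X Y \<in> C"
  using metric by (simp add: riemannian_metric_def)

lemma g_linear:
  assumes "u \<in> tangent_space A p" "v \<in> tangent_space A p" "w \<in> tangent_space A p"
  shows "g p (u + v) w = g p u w + g p v w" "g p w (u + v) = g p w u + g p w v"
    and "g p (r *\<^sub>R u) w = r * g p u w" "g p w (r *\<^sub>R u) = r * g p w u"
proof -
  have b: "g p (r *\<^sub>R u + s *\<^sub>R v) w = r * g p u w + s * g p v w"
      "g p w (r *\<^sub>R u + s *\<^sub>R v) = r * g p w u + s * g p w v" for r s
    using assms metric unfolding riemannian_metric_def bilinear_at_def by auto
  show "g p (u + v) w = g p u w + g p v w" "g p w (u + v) = g p w u + g p w v"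
    "g p (r *\<^sub>R u) w = r * g p u w" "g p w (r *\<^sub>R u) = r * g p w u"
    using b[of 1 1] b[of r 0] by simp_all
qed

lemma g_fields_add:
  assumes "X \<in> VF" "Y \<in> VF" "Z \<in> VF"
  shows "ev g (X + Y) Z = ev g X Z + ev g Y Z" "ev g Z (X + Y) = ev g Z X + ev g Z Y"
  by (simp_all add: ev_def fun_eq_iff g_linear(1,2)[OF vector_fieldD[OF assms(1)] vector_fieldD[OF assms(2)] vector_fieldD[OF assms(3)]])

lemma g_fields_fmul:
  assumes "X \<in> VF" "Y \<in> VF"
  shows "ev g (fmul h X) Y = h * ev g X Y" "ev g Y (fmul h X) = h * ev g Y X"
  by (simp_all add: ev_def fmul_def fun_eq_iff g_linear(3,4)[OF vector_fieldD[OF assms(1)] vector_fieldD[OF assms(1)] vector_fieldD[OF assms(2)]])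

lemma g_sym: "X \<in> VF \<Longrightarrow> Y \<in> VF \<Longrightarrow> ev g X Y = ev g Y X"
  using metric by (simp add: riemannian_metric_def ev_def fun_eq_iff vector_fieldD)

lemma frame_comps [simp]:
  "comp1 e1 = 1" "comp2 e1 = 0" "comp3 e1 = 0"
  "comp1 e2 = 0" "comp2 e2 = 1" "comp3 e2 = 0"
  "comp1 e3 = 0" "comp2 e3 = 0" "comp3 e3 = 1"
  using e_orthonormal e_distinct unfolding orthonormal_fields_def zero_fun_def one_fun_def by auto

text \<open>Orthonormal vectors are independent, and three independent vectors span a tangent space of
  dimension three.\<close>

lemma tangent_vector_expansion:
  assumes w: "w \<in> tangent_space A p"
  shows "w = g p w (e1 p) *\<^sub>R e1 p + g p w (e2 p) *\<^sub>R e2 p + g p w (e3 p) *\<^sub>R e3 p"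
proof -
  note T = vector_fieldD[OF e_fields(1), of p] vector_fieldD[OF e_fields(2), of p]
    vector_fieldD[OF e_fields(3), of p]
  note sub = subspace_tangent_space[OF atlas, of p]
  have o: "g p (e1 p) (e1 p) = 1" "g p (e1 p) (e2 p) = 0" "g p (e1 p) (e3 p) = 0"
    "g p (e2 p) (e1 p) = 0" "g p (e2 p) (e2 p) = 1" "g p (e2 p) (e3 p) = 0"
    "g p (e3 p) (e1 p) = 0" "g p (e3 p) (e2 p) = 0" "g p (e3 p) (e3 p) = 1"
    using frame_comps by (auto simp: ev_def fun_eq_iff)
  have comb: "g p (a *\<^sub>R e1 p + b *\<^sub>R e2 p + c *\<^sub>R e3 p) (e1 p) = a"
      "g p (a *\<^sub>R e1 p + b *\<^sub>R e2 p + c *\<^sub>R e3 p) (e2 p) = b"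
      "g p (a *\<^sub>R e1 p + b *\<^sub>R e2 p + c *\<^sub>R e3 p) (e3 p) = c" for a b c
    using T o sub by (simp_all add: g_linear subspace_add subspace_scale)
  have dist: "e1 p \<noteq> e2 p" "e1 p \<noteq> e3 p" "e2 p \<noteq> e3 p"
    using o by auto
  have span: "x \<in> span {e1 p, e2 p, e3 p} \<longleftrightarrow> (\<exists>a b c. x = a *\<^sub>R e1 p + b *\<^sub>R e2 p + c *\<^sub>R e3 p)" for x
  proof -
    have "x \<in> span {e1 p, e2 p, e3 p} \<longleftrightarrow> (\<exists>a b c. x - a *\<^sub>R e1 p - b *\<^sub>R e2 p = c *\<^sub>R e3 p)"
      unfolding span_insert[of "e1 p"] span_insert[of "e2 p"] span_singleton by auto
    moreover have "x - u - v = w \<longleftrightarrow> x = u + v + w" for u v w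
      by auto
    ultimately show ?thesis by simp
  qed
  have coeffs: "f x = 0"
    if z: "(\<Sum>x\<in>{e1 p, e2 p, e3 p}. f x *\<^sub>R x) = 0" and x: "x \<in> {e1 p, e2 p, e3 p}" for f x
  proof -
    have "f (e1 p) *\<^sub>R e1 p + f (e2 p) *\<^sub>R e2 p + f (e3 p) *\<^sub>R e3 p = 0"
      using z dist by (simp add: add.assoc)
    then have "f (e1 p) = g p 0 (e1 p)" "f (e2 p) = g p 0 (e2 p)" "f (e3 p) = g p 0 (e3 p)"
      using comb[of "f (e1 p)" "f (e2 p)" "f (e3 p)"] by simp_all
    moreover have "g p 0 (e1 p) = 0" "g p 0 (e2 p) = 0" "g p 0 (e3 p) = 0"
      using comb[of 0 0 0] by simp_all
    ultimately show "f x = 0"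
      using x by (simp only: insert_iff empty_iff) metis
  qed
  have "independent {e1 p, e2 p, e3 p}"
    apply (rule independent_if_scalars_zero)
     apply simp
    subgoal for f x by (rule coeffs[of f x])
    done
  then have "tangent_space A p \<subseteq> span {e1 p, e2 p, e3 p}"
    using dist T by (intro independent_spans_tangent_space atlas) auto
  then have "w \<in> span {e1 p, e2 p, e3 p}"
    using w by (rule subsetD)
  then obtain a b c where abc: "w = a *\<^sub>R e1 p + b *\<^sub>R e2 p + c *\<^sub>R e3 p"
    using iffD1[OF span] by metis
  show ?thesis
    unfolding abc comb ..
qed

text \<open>The vector fields form a free module over the smooth functions. The coefficients are smooth
  because they are values of the metric.\<close>

lemma field_expansion:
  assumes "X \<in> VF"
  shows "X = comb (comp1 X) (comp2 X) (comp3 X)"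
proof
  fix p
  have "X p = g p (X p) (e1 p) *\<^sub>R e1 p + g p (X p) (e2 p) *\<^sub>R e2 p + g p (X p) (e3 p) *\<^sub>R e3 p"
    by (rule tangent_vector_expansion[OF vector_fieldD[OF assms]])
  also have "\<dots> = comb (comp1 X) (comp2 X) (comp3 X) p"
    by (simp add: frame_comb_def ev_def fmul_def)
  finally show "X p = comb (comp1 X) (comp2 X) (comp3 X) p" .
qed

lemma comps_comb [simp]:
  assumes "x1 \<in> C" "x2 \<in> C" "x3 \<in> C"
  shows "comp1 (comb x1 x2 x3) = x1" "comp2 (comb x1 x2 x3) = x2" "comp3 (comb x1 x2 x3) = x3"
  using assms by (simp_all add: frame_comb_def g_fields_add g_fields_fmul)

lemma field_eqI:
  assumes "X \<in> VF" "Y \<in> VF" "comp1 X = comp1 Y" "comp2 X = comp2 Y" "comp3 X = comp3 Y"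
  shows "X = Y"
  using field_expansion assms by metis

lemma comps_add [simp]:
  assumes "X \<in> VF" "Y \<in> VF"
  shows "comp1 (X + Y) = comp1 X + comp1 Y" "comp2 (X + Y) = comp2 X + comp2 Y"
    "comp3 (X + Y) = comp3 X + comp3 Y"
  using assms by (simp_all add: g_fields_add)

lemma comps_fmul [simp]:
  assumes "X \<in> VF"
  shows "comp1 (fmul h X) = h * comp1 X" "comp2 (fmul h X) = h * comp2 X" "comp3 (fmul h X) = h * comp3 X"
  using assms by (simp_all add: g_fields_fmul)

lemma comps_diff [simp]:
  assumes "X \<in> VF" "Y \<in> VF"
  shows "comp1 (X - Y) = comp1 X - comp1 Y" "comp2 (X - Y) = comp2 X - comp2 Y"
    "comp3 (X - Y) = comp3 X - comp3 Y"
  using comps_add[of "X - Y" Y] assms by (simp_all add: eq_diff_eq)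

lemma comps_0 [simp]: "comp1 0 = 0" "comp2 0 = 0" "comp3 0 = 0"
  using comps_diff[of e1 e1] by simp_all

lemma g_comps:
  assumes "X \<in> VF" "Y \<in> VF"
  shows "ev g X Y = comp1 X * comp1 Y + comp2 X * comp2 Y + comp3 X * comp3 Y"
proof -
  have "ev g X Y = ev g X (comb (comp1 Y) (comp2 Y) (comp3 Y))"
    using field_expansion[OF assms(2)] by simp
  then show ?thesis
    using assms by (simp add: frame_comb_def g_fields_add g_fields_fmul algebra_simps)
qed

lemma deriv_along_frame:
  assumes "X \<in> VF"
  shows "deriv_along X f =
    comp1 X * deriv_along e1 f + comp2 X * deriv_along e2 f + comp3 X * deriv_along e3 f"
  using arg_cong[OF field_expansion[OF assms], of "\<lambda>X. deriv_along X f"]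
  by (simp add: frame_comb_def deriv_along_combine)

text \<open>The operator \<open>bracket X Y\<close> is a second order expression whose second order part cancels: this is
  clear from the Leibniz rule and the given brackets of the frame. In particular it is a vector
  field, without any computation in charts.\<close>

lemma bracket_frame:
  assumes X: "X \<in> VF" and Y: "Y \<in> VF"
  shows "bracket X Y = comb
    (deriv_along X (comp1 Y) - deriv_along Y (comp1 X) + const_fun c1 * (comp2 X * comp3 Y - comp3 X * comp2 Y))
    (deriv_along X (comp2 Y) - deriv_along Y (comp2 X) + const_fun c2 * (comp3 X * comp1 Y - comp1 X * comp3 Y))
    (deriv_along X (comp3 Y) - deriv_along Y (comp3 X) + const_fun c3 * (comp1 X * comp2 Y - comp2 X * comp1 Y))"
    (is "_ = ?R")
proof (rule vector_fields_eqI)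
  fix f
  show "deriv_along (bracket X Y) f = deriv_along ?R f"
  proof (cases "f \<in> C")
    case False
    \<comment> \<open>Tangent vectors are normalised to 0 on functions that are not smooth.\<close>
    then have "?R \<in> VF" "deriv_along X f = 0" "deriv_along Y f = 0"
      using X Y deriv_along_nonsmooth by auto
    then show ?thesis
      using False X Y deriv_along_nonsmooth[of ?R A f] by (simp add: deriv_along_bracket)
  next
    case f: True
    let ?E1 = "deriv_along e1" and ?E2 = "deriv_along e2" and ?E3 = "deriv_along e3"
    have br: "?E1 (?E2 f) = ?E2 (?E1 f) + const_fun c3 * ?E3 f"
      "?E2 (?E3 f) = ?E3 (?E2 f) + const_fun c1 * ?E1 f"
      "?E3 (?E1 f) = ?E1 (?E3 f) + const_fun c2 * ?E2 f"
      using arg_cong[OF bracket12, of "\<lambda>X. deriv_along X f"] arg_cong[OF bracket23, of "\<lambda>X. deriv_along X f"]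
        arg_cong[OF bracket31, of "\<lambda>X. deriv_along X f"]
      by (simp_all add: deriv_along_bracket deriv_along_combine diff_eq_eq add.commute)
    \<comment> \<open>Second derivatives in terms of those along the frame; \<open>br\<close> then sorts the mixed ones.\<close>
    have second: "deriv_along V (deriv_along W f) =
        deriv_along V (comp1 W) * ?E1 f + deriv_along V (comp2 W) * ?E2 f + deriv_along V (comp3 W) * ?E3 f
        + comp1 W * (comp1 V * ?E1 (?E1 f) + comp2 V * ?E2 (?E1 f) + comp3 V * ?E3 (?E1 f))
        + comp2 W * (comp1 V * ?E1 (?E2 f) + comp2 V * ?E2 (?E2 f) + comp3 V * ?E3 (?E2 f))
        + comp3 W * (comp1 V * ?E1 (?E3 f) + comp2 V * ?E2 (?E3 f) + comp3 V * ?E3 (?E3 f))"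
      if "V \<in> VF" "W \<in> VF" for V W
    proof -
      have "deriv_along V (deriv_along W f) =
          deriv_along V (comp1 W * ?E1 f + comp2 W * ?E2 f + comp3 W * ?E3 f)"
        by (rule arg_cong[OF deriv_along_frame[OF that(2)]])
      also have "\<dots> = deriv_along V (comp1 W) * ?E1 f + deriv_along V (comp2 W) * ?E2 f
          + deriv_along V (comp3 W) * ?E3 f + comp1 W * deriv_along V (?E1 f)
          + comp2 W * deriv_along V (?E2 f) + comp3 W * deriv_along V (?E3 f)"
        using that f by simp
      finally show ?thesis
        unfolding deriv_along_frame[OF that(1), of "deriv_along _ f"] .
    qed
    show ?thesis
      unfolding deriv_along_bracket second[OF X Y] second[OF Y X] frame_comb_def deriv_along_combine br
      by (simp add: algebra_simps)
  qed
qed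

lemma bracket_closed [simp]: "X \<in> VF \<Longrightarrow> Y \<in> VF \<Longrightarrow> bracket X Y \<in> VF"
  by (simp add: bracket_frame)

section \<open>Diagonal connections and the Levi-Civita connection\<close>

abbreviation "m1 \<equiv> milnor_const c1 c2 c3"
abbreviation "m2 \<equiv> milnor_const c2 c3 c1"
abbreviation "m3 \<equiv> milnor_const c3 c1 c2"

text \<open>In components this is \<open>X(Y) + (a X) \<times> Y\<close> with the diagonal matrix \<open>a\<close>, that is, the connection
  with \<open>\<nabla> e\<^sub>i e\<^sub>j = a\<^sub>i e\<^sub>k\<close> for cyclic \<open>(i, j, k)\<close>. It is the Levi-Civita connection for Milnor's constants,
  and the Cartan-Schouten \<open>(-)\<close>-connection for \<open>a = 0\<close>.\<close>

definition diag_conn :: "real \<Rightarrow> real \<Rightarrow> real \<Rightarrow> 'a connection" where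
  "diag_conn a1 a2 a3 X Y = (if X \<in> VF \<and> Y \<in> VF then comb
     (deriv_along X (comp1 Y) + const_fun a2 * comp2 X * comp3 Y - const_fun a3 * comp3 X * comp2 Y)
     (deriv_along X (comp2 Y) + const_fun a3 * comp3 X * comp1 Y - const_fun a1 * comp1 X * comp3 Y)
     (deriv_along X (comp3 Y) + const_fun a1 * comp1 X * comp2 Y - const_fun a2 * comp2 X * comp1 Y)
   else 0)"

lemma diag_conn_closed [simp]: "X \<in> VF \<Longrightarrow> Y \<in> VF \<Longrightarrow> diag_conn a1 a2 a3 X Y \<in> VF"
  by (simp add: diag_conn_def)

lemma diag_conn_comps [simp]:
  assumes "X \<in> VF" "Y \<in> VF"
  shows "comp1 (diag_conn a1 a2 a3 X Y) =
      deriv_along X (comp1 Y) + const_fun a2 * comp2 X * comp3 Y - const_fun a3 * comp3 X * comp2 Y"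
    "comp2 (diag_conn a1 a2 a3 X Y) =
      deriv_along X (comp2 Y) + const_fun a3 * comp3 X * comp1 Y - const_fun a1 * comp1 X * comp3 Y"
    "comp3 (diag_conn a1 a2 a3 X Y) =
      deriv_along X (comp3 Y) + const_fun a1 * comp1 X * comp2 Y - const_fun a2 * comp2 X * comp1 Y"
  using assms by (simp_all add: diag_conn_def)

lemma diag_conn_linear_connection: "linear_connection A (diag_conn a1 a2 a3)"
  unfolding linear_connection_def
proof (intro conjI ballI allI impI)
  fix X Y Z assume XYZ: "X \<in> VF" "Y \<in> VF" "Z \<in> VF"
  show "diag_conn a1 a2 a3 (X + Y) Z = diag_conn a1 a2 a3 X Z + diag_conn a1 a2 a3 Y Z"
    using XYZ by (intro field_eqI) (simp_all add: deriv_along_combine algebra_simps)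
  show "diag_conn a1 a2 a3 X (Y + Z) = diag_conn a1 a2 a3 X Y + diag_conn a1 a2 a3 X Z"
    using XYZ by (intro field_eqI) (simp_all add: algebra_simps)
next
  fix X Y h assume XY: "X \<in> VF" "Y \<in> VF" and h: "h \<in> C"
  show "diag_conn a1 a2 a3 (fmul h X) Y = fmul h (diag_conn a1 a2 a3 X Y)"
    using XY h by (intro field_eqI) (simp_all add: deriv_along_combine algebra_simps)
  show "diag_conn a1 a2 a3 X (fmul h Y) = fmul (deriv_along X h) Y + fmul h (diag_conn a1 a2 a3 X Y)"
    using XY h by (intro field_eqI) (simp_all add: algebra_simps)
qed (auto simp: diag_conn_def)

text \<open>The cross product with \<open>a X\<close> is a skew-symmetric operator.\<close>

lemma diag_conn_metric: "parallel_metric A (diag_conn a1 a2 a3) g"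
  unfolding parallel_metric_def
proof (intro ballI)
  fix X Y Z assume XYZ: "X \<in> VF" "Y \<in> VF" "Z \<in> VF"
  let ?D = "diag_conn a1 a2 a3"
  show "deriv_along X (ev g Y Z) - ev g (?D X Y) Z - ev g Y (?D X Z) = 0"
    unfolding g_comps[OF XYZ(2,3)] g_comps[OF diag_conn_closed[OF XYZ(1,2)] XYZ(3)]
      g_comps[OF XYZ(2) diag_conn_closed[OF XYZ(1,3)]]
    using XYZ by (simp add: algebra_simps)
qed

lemma const_fun_structure_constants:
  "const_fun c1 = const_fun m2 + const_fun m3"
  "const_fun c2 = const_fun m3 + const_fun m1"
  "const_fun c3 = const_fun m1 + const_fun m2"
  by (simp_all add: const_fun_ring(1)[symmetric] milnor_const_def field_simps)

lemma bracket_comps: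
  assumes "X \<in> VF" "Y \<in> VF"
  shows "comp1 (bracket X Y) = deriv_along X (comp1 Y) - deriv_along Y (comp1 X)
      + const_fun c1 * (comp2 X * comp3 Y - comp3 X * comp2 Y)"
    "comp2 (bracket X Y) = deriv_along X (comp2 Y) - deriv_along Y (comp2 X)
      + const_fun c2 * (comp3 X * comp1 Y - comp1 X * comp3 Y)"
    "comp3 (bracket X Y) = deriv_along X (comp3 Y) - deriv_along Y (comp3 X)
      + const_fun c3 * (comp1 X * comp2 Y - comp2 X * comp1 Y)"
  using assms by (simp_all add: bracket_frame)

lemma diag_conn_torsion_free: "torsion_free A (diag_conn m1 m2 m3)"
  unfolding torsion_free_def
proof (intro ballI)
  fix X Y assume "X \<in> VF" "Y \<in> VF"
  then show "diag_conn m1 m2 m3 X Y - diag_conn m1 m2 m3 Y X = bracket X Y"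
    by (intro field_eqI) (simp_all add: bracket_comps const_fun_structure_constants algebra_simps)
qed

lemma g_fields_diff:
  assumes "X \<in> VF" "Y \<in> VF" "Z \<in> VF"
  shows "ev g (X - Y) Z = ev g X Z - ev g Y Z"
  using g_fields_add(1)[of "X - Y" Y Z] assms by (simp add: eq_diff_eq)

lemma parallel_metricD:
  assumes "parallel_metric A D g" "X \<in> VF" "Y \<in> VF" "Z \<in> VF"
  shows "ev g (D X Y) Z + ev g Y (D X Z) = deriv_along X (ev g Y Z)"
proof -
  have "deriv_along X (ev g Y Z) - ev g (D X Y) Z - ev g Y (D X Z) = 0"
    using assms by (simp add: parallel_metric_def)
  then show ?thesis
    by (simp add: algebra_simps)
qed

text \<open>The difference of two such connections is symmetric in its two arguments and skew in the last
  two slots of \<open>g (T X Y) Z\<close>; alternating the two symmetries returns to the start with the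
  opposite sign.\<close>

lemma metric_torsion_free_unique:
  assumes D: "linear_connection A D" "torsion_free A D" "parallel_metric A D g"
    and D': "linear_connection A D'" "torsion_free A D'" "parallel_metric A D' g"
  shows "D = D'"
proof -
  have eq: "D X Y = D' X Y" for X Y :: "'a vfield"
  proof (cases "X \<in> VF \<and> Y \<in> VF")
    case False
    then show ?thesis
      by (simp only: linear_connection_default[OF D(1)] linear_connection_default[OF D'(1)] simp_thms)
  next
    case True
    define T where "T X Y = D X Y - D' X Y" for X Y
    have cl: "D X Y \<in> VF" "D' X Y \<in> VF" if "X \<in> VF" "Y \<in> VF" for X Y
      using that linear_connection_closed D(1) D'(1) by blast+
    have sym: "T X Y = T Y X" if "X \<in> VF" "Y \<in> VF" for X Y
    proof -
      have "D X Y - D Y X = D' X Y - D' Y X"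
        using D(2) D'(2) that unfolding torsion_free_def by simp
      then show ?thesis
        unfolding T_def by (simp add: algebra_simps)
    qed
    have skew: "ev g (T X Y) Z = - ev g (T X Z) Y" if "X \<in> VF" "Y \<in> VF" "Z \<in> VF" for X Y Z
    proof -
      have "ev g (D X Y) Z + ev g Y (D X Z) = ev g (D' X Y) Z + ev g Y (D' X Z)"
        using parallel_metricD[OF D(3) that] parallel_metricD[OF D'(3) that] by simp
      then have "ev g (D X Y) Z + ev g (D X Z) Y = ev g (D' X Y) Z + ev g (D' X Z) Y"
        using that cl by (simp only: g_sym[of Y "D X Z"] g_sym[of Y "D' X Z"])
      then show ?thesis
        unfolding T_def g_fields_diff[OF cl(1)[OF that(1,2)] cl(2)[OF that(1,2)] that(3)]
          g_fields_diff[OF cl(1)[OF that(1,3)] cl(2)[OF that(1,3)] that(2)]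
        by (simp add: algebra_simps)
    qed
    have "ev g (T X Y) Z = 0" if Z: "Z \<in> VF" for Z
    proof (rule function_double_eq_0)
      from True have X: "X \<in> VF" and Y: "Y \<in> VF" by auto
      show "ev g (T X Y) Z = - ev g (T X Y) Z"
        using skew[OF X Y Z] skew[OF Z X Y] skew[OF Y Z X]
        unfolding sym[OF Z X] sym[OF Z Y] sym[OF Y X] by (metis minus_minus)
    qed
    moreover have "T X Y \<in> VF"
      using cl True by (simp add: T_def)
    ultimately have "T X Y = 0"
      by (intro field_eqI) simp_all
    then show ?thesis
      by (simp add: T_def)
  qed
  show ?thesis
    by (rule ext, rule ext, rule eq)
qed

lemma levi_civita_eq: "levi_civita A g = diag_conn m1 m2 m3"
  unfolding levi_civita_def
proof (rule the_equality)
  show "linear_connection A (diag_conn m1 m2 m3) \<and> torsion_free A (diag_conn m1 m2 m3) \<and>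
      parallel_metric A (diag_conn m1 m2 m3) g"
    using diag_conn_linear_connection diag_conn_torsion_free diag_conn_metric by blast
qed (use metric_torsion_free_unique diag_conn_linear_connection diag_conn_torsion_free
      diag_conn_metric in blast)

section \<open>Curvature\<close>

abbreviation "sect1 \<equiv> sect_const m1 m2 m3"
abbreviation "sect2 \<equiv> sect_const m2 m3 m1"
abbreviation "sect3 \<equiv> sect_const m3 m1 m2"

abbreviation "R \<equiv> curvature (levi_civita A g)"

lemma curvature_closed [simp]: "Y \<in> VF \<Longrightarrow> Z \<in> VF \<Longrightarrow> W \<in> VF \<Longrightarrow> R Y Z W \<in> VF"
  by (simp add: curvature_def levi_civita_eq)

text \<open>The frame diagonalises the curvature: \<open>R e\<^sub>i e\<^sub>j e\<^sub>k\<close> vanishes for distinct indices, and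
  \<open>R e\<^sub>i e\<^sub>j e\<^sub>j\<close> is the multiple of \<open>e\<^sub>i\<close> by the sectional curvature. In the calculation all
  derivatives of components cancel by the bracket formula.\<close>

lemma curvature_comp1:
  assumes "Y \<in> VF" "Z \<in> VF" "W \<in> VF"
  shows "comp1 (R Y Z W) =
      const_fun sect3 * (comp1 Y * comp2 Z - comp2 Y * comp1 Z) * comp2 W
    - const_fun sect2 * (comp3 Y * comp1 Z - comp1 Y * comp3 Z) * comp3 W"
  using assms
  by (simp add: curvature_def levi_civita_eq bracket_comps deriv_along_bracket sect_const_def
      const_fun_structure_constants const_fun_ring algebra_simps)

lemma curvature_comp2:
  assumes "Y \<in> VF" "Z \<in> VF" "W \<in> VF"
  shows "comp2 (R Y Z W) =
      const_fun sect1 * (comp2 Y * comp3 Z - comp3 Y * comp2 Z) * comp3 W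
    - const_fun sect3 * (comp1 Y * comp2 Z - comp2 Y * comp1 Z) * comp1 W"
  by (rule unimodular_frame.curvature_comp1[OF rotate assms])

lemma curvature_comp3:
  assumes "Y \<in> VF" "Z \<in> VF" "W \<in> VF"
  shows "comp3 (R Y Z W) =
      const_fun sect2 * (comp3 Y * comp1 Z - comp1 Y * comp3 Z) * comp1 W
    - const_fun sect1 * (comp2 Y * comp3 Z - comp3 Y * comp2 Z) * comp2 W"
  by (rule unimodular_frame.curvature_comp2[OF rotate assms])

abbreviation "flat_conn \<equiv> diag_conn 0 0 0"

text \<open>The curvature has constant coefficients in the frame, and \<open>flat_conn\<close> differentiates
  coefficients only.\<close>

lemma flat_conn_curvature: "parallel_curvature A flat_conn R"
  unfolding parallel_curvature_def
proof (intro ballI)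
  fix X Y Z W assume "X \<in> VF" "Y \<in> VF" "Z \<in> VF" "W \<in> VF"
  then show "flat_conn X (R Y Z W) - R (flat_conn X Y) Z W - R Y (flat_conn X Z) W
      - R Y Z (flat_conn X W) = 0"
    by (intro field_eqI)
       (simp_all add: curvature_comp1 curvature_comp2 curvature_comp3 algebra_simps)
qed

section \<open>Determination of the Ambrose-Singer connection\<close>

text \<open>A connection is determined by the derivatives of the frame, by the Leibniz rule.\<close>

lemma connection_eq_flat_conn:
  assumes D: "linear_connection A D"
    and frame: "\<And>X. X \<in> VF \<Longrightarrow> D X e1 = 0" "\<And>X. X \<in> VF \<Longrightarrow> D X e2 = 0" "\<And>X. X \<in> VF \<Longrightarrow> D X e3 = 0"
  shows "D = flat_conn"
proof -
  have eq: "D X Y = flat_conn X Y" for X Y :: "'a vfield"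
  proof (cases "X \<in> VF \<and> Y \<in> VF")
    case False
    then show ?thesis
      by (simp only: linear_connection_default[OF D] diag_conn_def if_False simp_thms)
  next
    case True
    then have X: "X \<in> VF" and Y: "Y \<in> VF" by auto
    have add: "D X (V + W) = D X V + D X W" if "V \<in> VF" "W \<in> VF" for V W
      by (rule linear_connection_add(2)[OF D X that])
    have mul: "D X (fmul h V) = fmul (deriv_along X h) V + fmul h (D X V)"
      if "V \<in> VF" "h \<in> C" for V h
      by (rule linear_connection_fmul(2)[OF D X that])
    have "D X Y = D X (comb (comp1 Y) (comp2 Y) (comp3 Y))"
      by (rule arg_cong[OF field_expansion[OF Y]])
    also have "\<dots> = flat_conn X Y"
      using X Y unfolding diag_conn_def by (simp add: frame_comb_def add mul frame)
    finally show ?thesis .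
  qed
  show ?thesis
    by (rule ext, rule ext, rule eq)
qed

lemma ambrose_singer_eq:
  "X \<in> VF \<Longrightarrow> Y \<in> VF \<Longrightarrow> ambrose_singer A g S X Y = diag_conn m1 m2 m3 X Y + ev S X Y"
  by (simp add: ambrose_singer_def levi_civita_eq)

lemma ambrose_singer_connection:
  assumes S: "tensor_field12 A S"
  shows "linear_connection A (ambrose_singer A g S)"
proof -
  note lc = diag_conn_linear_connection[of m1 m2 m3]
  show ?thesis
    unfolding linear_connection_def
  proof (intro conjI ballI allI impI)
    fix X Y Z assume XYZ: "X \<in> VF" "Y \<in> VF" "Z \<in> VF"
    show "ambrose_singer A g S (X + Y) Z = ambrose_singer A g S X Z + ambrose_singer A g S Y Z"
      using XYZ by (simp add: ambrose_singer_eq linear_connection_add[OF lc] tensor_ev_add(1)[OF S])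
    show "ambrose_singer A g S X (Y + Z) = ambrose_singer A g S X Y + ambrose_singer A g S X Z"
      using XYZ by (simp add: ambrose_singer_eq linear_connection_add[OF lc] tensor_ev_add(2)[OF S])
  next
    fix X Y h assume XY: "X \<in> VF" "Y \<in> VF" and h: "h \<in> C"
    show "ambrose_singer A g S (fmul h X) Y = fmul h (ambrose_singer A g S X Y)"
      using XY h
      by (simp add: ambrose_singer_eq linear_connection_fmul[OF lc] tensor_ev_fmul[OF S] fmul_add)
    show "ambrose_singer A g S X (fmul h Y) =
        fmul (deriv_along X h) Y + fmul h (ambrose_singer A g S X Y)"
      using XY h
      by (simp add: ambrose_singer_eq linear_connection_fmul[OF lc] tensor_ev_fmul[OF S] fmul_add)
  next
    fix X Y assume "X \<in> VF" "Y \<in> VF"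
    then show "ambrose_singer A g S X Y \<in> VF"
      using tensor_ev_closed[OF S] by (simp add: ambrose_singer_eq)
  next
    fix X Y assume "\<not> (X \<in> VF \<and> Y \<in> VF)"
    then show "ambrose_singer A g S X Y = 0"
      by (simp only: ambrose_singer_def if_False simp_thms)
  qed
qed

text \<open>The frame has constant inner products, so the connection matrix \<open>g (D X e\<^sub>i) e\<^sub>j\<close> is
  skew-symmetric; three of its entries determine it.\<close>

lemma metric_connection_skew:
  assumes D: "linear_connection A D" "parallel_metric A D g" and X: "X \<in> VF"
  shows "comp1 (D X e1) = 0" "comp2 (D X e2) = 0" "comp3 (D X e3) = 0"
    "comp1 (D X e2) = - comp2 (D X e1)" "comp3 (D X e1) = - comp1 (D X e3)"
    "comp2 (D X e3) = - comp3 (D X e2)"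
proof -
  have cl: "D X e1 \<in> VF" "D X e2 \<in> VF" "D X e3 \<in> VF"
    using linear_connection_closed[OF D(1) X] by simp_all
  have sk: "ev g (D X Y) Z = - ev g (D X Z) Y"
    if "Y \<in> VF" "Z \<in> VF" "ev g Y Z = const_fun r" for Y Z r
    using parallel_metricD[OF D(2) X that(1,2)] that X
      g_sym[OF that(1) linear_connection_closed[OF D(1) X that(2)]]
    by (simp add: eq_neg_iff_add_eq_0)
  show "comp1 (D X e1) = 0" "comp2 (D X e2) = 0" "comp3 (D X e3) = 0"
    by (rule function_double_eq_0, rule sk[where r = 1]; simp)+
  show "comp1 (D X e2) = - comp2 (D X e1)" "comp3 (D X e1) = - comp1 (D X e3)"
    "comp2 (D X e3) = - comp3 (D X e2)"
    by (rule sk[where r = 0]; simp)+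
qed

text \<open>Differentiate \<open>R e\<^sub>1 e\<^sub>2 e\<^sub>3 = 0\<close>. The first component of the result is the product of the
  connection coefficient and the difference of two sectional curvatures, which is
  \<open>2 \<mu>\<^sub>1 (c\<^sub>3 - c\<^sub>2)\<close>.\<close>

lemma parallel_curvature_coefficient_0:
  assumes D: "linear_connection A D" "parallel_metric A D g" "parallel_curvature A D R"
    and X: "X \<in> VF" and c: "c2 \<noteq> c3" "m1 \<noteq> 0"
  shows "comp3 (D X e2) = 0"
proof -
  have cl [simp]: "D X e1 \<in> VF" "D X e2 \<in> VF" "D X e3 \<in> VF"
    using linear_connection_closed[OF D(1) X] by simp_all
  note skew = metric_connection_skew[OF D(1,2) X]
  have zero: "R e1 e2 e3 = 0"
    by (intro field_eqI) (simp_all add: curvature_comp1 curvature_comp2 curvature_comp3)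
  have D0: "D X 0 = 0"
    using linear_connection_add(2)[OF D(1) X, of 0 0] by simp
  have "D X (R e1 e2 e3) - R (D X e1) e2 e3 - R e1 (D X e2) e3 - R e1 e2 (D X e3) = 0"
    using D(3) X by (simp add: parallel_curvature_def)
  then have "R (D X e1) e2 e3 + R e1 (D X e2) e3 + R e1 e2 (D X e3) = 0"
    unfolding zero D0 by (rule diff_diff_diff_eq_0)
  then have "comp1 (R (D X e1) e2 e3 + R e1 (D X e2) e3 + R e1 e2 (D X e3)) = 0"
    by (simp only: comps_0)
  then have "const_fun (sect2 - sect3) * comp3 (D X e2) = 0"
    by (simp add: curvature_comp1 skew const_fun_ring algebra_simps)
  moreover have "sect2 - sect3 = 2 * m1 * (c3 - c2)"
    by (simp add: sect_const_def milnor_const_def field_simps)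
  then have "sect2 - sect3 \<noteq> 0"
    using c by simp
  ultimately show ?thesis
    by (rule const_fun_mult_eq_0)
qed

text \<open>The curvature says nothing about this coefficient if \<open>\<mu>\<^sub>1 = 0\<close>, when it is invariant
  under the rotations about \<open>e\<^sub>1\<close>. In that case the parallel structure \<open>S\<close> has to be used. Since
  \<open>\<mu>\<^sub>2\<close> and \<open>\<mu>\<^sub>3\<close> do not vanish, \<open>e\<^sub>1\<close> is parallel, so
  \<open>S V e\<^sub>1 = - \<nabla> V e\<^sub>1\<close> is a known operator in \<open>V\<close>. It is parallel, hence commutes with the
  infinitesimal rotation \<open>D X\<close> of the plane of \<open>e\<^sub>2\<close> and \<open>e\<^sub>3\<close>; but it does not commute with
  nonzero rotations, because \<open>\<mu>\<^sub>2 \<noteq> \<mu>\<^sub>3\<close>.\<close>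

lemma homogeneous_structure_coefficient_0:
  assumes S: "homogeneous_structure A g S" and X: "X \<in> VF"
    and c: "c1 \<noteq> c2" "c2 \<noteq> c3" "c1 \<noteq> c3"
  shows "comp3 (ambrose_singer A g S X e2) = 0"
proof -
  let ?D = "ambrose_singer A g S"
  have tensor: "tensor_field12 A S" and D: "parallel_metric A ?D g" "parallel_curvature A ?D R"
    and par: "parallel_tensor12 A ?D S"
    using S unfolding homogeneous_structure_def by auto
  note conn = ambrose_singer_connection[OF tensor]
  show ?thesis
  proof (cases "m1 = 0")
    case False
    show ?thesis
      by (rule parallel_curvature_coefficient_0[OF conn D X c(2) False])
  next
    case True
    \<comment> \<open>Here \<open>c1 = c2 + c3\<close>, so that \<open>m2 = c3\<close> and \<open>m3 = c2\<close>; if either vanished, two of the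
      constants would be equal.\<close>
    have "m2 \<noteq> 0" "m3 \<noteq> 0" "m2 - m3 \<noteq> 0"
      using True c unfolding milnor_const_def by auto
    have e1_parallel: "?D V e1 = 0" if V: "V \<in> VF" for V
    proof -
      have "comp1 (?D V e3) = 0"
        by (rule unimodular_frame.parallel_curvature_coefficient_0[OF rotate conn D V])
           (use c \<open>m2 \<noteq> 0\<close> in auto)
      moreover have "comp2 (?D V e1) = 0"
        by (rule unimodular_frame.parallel_curvature_coefficient_0[OF unimodular_frame.rotate[OF rotate] conn D V])
           (use c \<open>m3 \<noteq> 0\<close> in auto)
      ultimately show ?thesis
        using metric_connection_skew[OF conn D(1) V] linear_connection_closed[OF conn V e_fields(1)]
        by (intro field_eqI) simp_all
    qed
    have De: "?D X e2 \<in> VF" "?D X e3 \<in> VF"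
      using linear_connection_closed[OF conn X] by simp_all
    have S_closed: "ev S V e1 \<in> VF" if "V \<in> VF" for V
      using tensor_ev_closed[OF tensor that] by simp
    have S_e1: "comp1 (ev S V e1) = - comp1 (diag_conn m1 m2 m3 V e1)"
        "comp2 (ev S V e1) = - comp2 (diag_conn m1 m2 m3 V e1)"
        "comp3 (ev S V e1) = - comp3 (diag_conn m1 m2 m3 V e1)" if V: "V \<in> VF" for V
    proof -
      have "ev S V e1 + diag_conn m1 m2 m3 V e1 = 0"
        using ambrose_singer_eq[OF V e_fields(1), of S] e1_parallel[OF V] by (simp only: add.commute)
      then have "comp1 (ev S V e1 + diag_conn m1 m2 m3 V e1) = 0"
          "comp2 (ev S V e1 + diag_conn m1 m2 m3 V e1) = 0"
          "comp3 (ev S V e1 + diag_conn m1 m2 m3 V e1) = 0"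
        by (simp_all only: comps_0)
      then show "comp1 (ev S V e1) = - comp1 (diag_conn m1 m2 m3 V e1)"
          "comp2 (ev S V e1) = - comp2 (diag_conn m1 m2 m3 V e1)"
          "comp3 (ev S V e1) = - comp3 (diag_conn m1 m2 m3 V e1)"
        unfolding comps_add[OF S_closed[OF V] diag_conn_closed[OF V e_fields(1)]]
        by (simp_all only: eq_neg_iff_add_eq_0)
    qed
    have S21: "ev S e2 e1 = fmul (const_fun m2) e3"
      by (rule field_eqI) (simp_all add: S_closed S_e1)
    have S0: "ev S e2 0 = 0"
      using tensor_ev_add(2)[OF tensor vector_fields_0[OF atlas e_fields(1)] vector_fields_0[OF atlas e_fields(1)] e_fields(2)]
      by simp
    have "?D X (ev S e2 e1) - ev S (?D X e2) e1 - ev S e2 (?D X e1) = 0"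
      using par X by (simp add: parallel_tensor12_def)
    then have "?D X (fmul (const_fun m2) e3) - ev S (?D X e2) e1 = 0"
      unfolding S21 e1_parallel[OF X] S0 by simp
    then have "comp2 (?D X (fmul (const_fun m2) e3) - ev S (?D X e2) e1) = 0"
      by (simp only: comps_0)
    moreover have "?D X (fmul (const_fun m2) e3) = fmul (const_fun m2) (?D X e3)"
      using X linear_connection_fmul(2)[OF conn X e_fields(3), of "const_fun m2"] by simp
    ultimately have "comp2 (fmul (const_fun m2) (?D X e3) - ev S (?D X e2) e1) = 0"
      by simp
    then have "const_fun (m2 - m3) * comp3 (?D X e2) = 0"
      using De metric_connection_skew[OF conn D(1) X]
      by (simp add: S_closed S_e1 const_fun_ring algebra_simps)
    then show ?thesis
      using \<open>m2 - m3 \<noteq> 0\<close> by (rule const_fun_mult_eq_0)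
  qed
qed

lemma ambrose_singer_eq_flat_conn:
  assumes S: "homogeneous_structure A g S" and c: "c1 \<noteq> c2" "c2 \<noteq> c3" "c1 \<noteq> c3"
  shows "ambrose_singer A g S = flat_conn"
proof -
  let ?D = "ambrose_singer A g S"
  have tensor: "tensor_field12 A S" and metric: "parallel_metric A ?D g"
    using S unfolding homogeneous_structure_def by auto
  note conn = ambrose_singer_connection[OF tensor]
  have "?D X e1 = 0 \<and> ?D X e2 = 0 \<and> ?D X e3 = 0" if X: "X \<in> VF" for X
  proof -
    have "comp3 (?D X e2) = 0"
      by (rule homogeneous_structure_coefficient_0[OF S X c])
    moreover have "comp1 (?D X e3) = 0"
      by (rule unimodular_frame.homogeneous_structure_coefficient_0[OF rotate S X]) (use c in auto)
    moreover have "comp2 (?D X e1) = 0"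
      by (rule unimodular_frame.homogeneous_structure_coefficient_0[OF unimodular_frame.rotate[OF rotate] S X])
         (use c in auto)
    moreover have "?D X e1 \<in> VF" "?D X e2 \<in> VF" "?D X e3 \<in> VF"
      using linear_connection_closed[OF conn X] by simp_all
    ultimately show ?thesis
      using metric_connection_skew[OF conn metric X] by (intro conjI field_eqI) simp_all
  qed
  then show ?thesis
    by (intro connection_eq_flat_conn[OF conn]) simp_all
qed

section \<open>The structure of the Cartan-Schouten connection\<close>

text \<open>The difference \<open>flat_conn - \<nabla>\<close>, that is \<open>- (\<mu> u) \<times> v\<close> with the diagonal matrix \<open>\<mu>\<close> of Milnor's
  constants, written pointwise and extended by 0 to arguments that are not tangent vectors.\<close>

definition minus_structure :: "'a tensor12" where
  "minus_structure p u v = (if u \<in> tangent_space A p \<and> v \<in> tangent_space A p then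
     (m3 * g p u (e3 p) * g p v (e2 p) - m2 * g p u (e2 p) * g p v (e3 p)) *\<^sub>R e1 p +
     (m1 * g p u (e1 p) * g p v (e3 p) - m3 * g p u (e3 p) * g p v (e1 p)) *\<^sub>R e2 p +
     (m2 * g p u (e2 p) * g p v (e1 p) - m1 * g p u (e1 p) * g p v (e2 p)) *\<^sub>R e3 p else 0)"

lemma minus_structure_ev:
  assumes "X \<in> VF" "Y \<in> VF"
  shows "ev minus_structure X Y = comb
    (const_fun m3 * comp3 X * comp2 Y - const_fun m2 * comp2 X * comp3 Y)
    (const_fun m1 * comp1 X * comp3 Y - const_fun m3 * comp3 X * comp1 Y)
    (const_fun m2 * comp2 X * comp1 Y - const_fun m1 * comp1 X * comp2 Y)"
  by (rule ext)
     (simp add: ev_def minus_structure_def vector_fieldD[OF assms(1)] vector_fieldD[OF assms(2)]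
       frame_comb_def fmul_def const_fun_def)

lemma minus_structure_ev_closed [simp]:
  "X \<in> VF \<Longrightarrow> Y \<in> VF \<Longrightarrow> ev minus_structure X Y \<in> VF"
  by (simp add: minus_structure_ev)

lemma minus_structure_comps:
  assumes "X \<in> VF" "Y \<in> VF"
  shows "comp1 (ev minus_structure X Y) = const_fun m3 * comp3 X * comp2 Y - const_fun m2 * comp2 X * comp3 Y"
    "comp2 (ev minus_structure X Y) = const_fun m1 * comp1 X * comp3 Y - const_fun m3 * comp3 X * comp1 Y"
    "comp3 (ev minus_structure X Y) = const_fun m2 * comp2 X * comp1 Y - const_fun m1 * comp1 X * comp2 Y"
  using assms by (simp_all add: minus_structure_ev)

lemma frame_tangent: "e1 p \<in> tangent_space A p" "e2 p \<in> tangent_space A p" "e3 p \<in> tangent_space A p"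
  by (simp_all add: vector_fieldD)

lemma minus_structure_tensor: "tensor_field12 A minus_structure"
  unfolding tensor_field12_def
proof (intro conjI allI ballI impI)
  fix p
  note sub = subspace_tangent_space[OF atlas, of p]
  show "bilinear_at A p (minus_structure p)"
    unfolding bilinear_at_def
  proof (intro ballI allI conjI)
    fix u v w and r s :: real
    assume T: "u \<in> tangent_space A p" "v \<in> tangent_space A p" "w \<in> tangent_space A p"
    have T': "r *\<^sub>R u \<in> tangent_space A p" "s *\<^sub>R v \<in> tangent_space A p"
        "r *\<^sub>R u + s *\<^sub>R v \<in> tangent_space A p"
      using T sub by (simp_all add: subspace_add subspace_scale)
    have lin: "g p (r *\<^sub>R u + s *\<^sub>R v) x = r * g p u x + s * g p v x"
      if "x \<in> tangent_space A p" for x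
      using T T' that by (simp add: g_linear)
    show "minus_structure p (r *\<^sub>R u + s *\<^sub>R v) w =
        r *\<^sub>R minus_structure p u w + s *\<^sub>R minus_structure p v w"
      using T T'
      by (simp only: minus_structure_def simp_thms if_True lin[OF frame_tangent(1)]
          lin[OF frame_tangent(2)] lin[OF frame_tangent(3)] frame_combination_linear[symmetric])
         (simp add: algebra_simps)
    show "minus_structure p w (r *\<^sub>R u + s *\<^sub>R v) =
        r *\<^sub>R minus_structure p w u + s *\<^sub>R minus_structure p w v"
      using T T'
      by (simp only: minus_structure_def simp_thms if_True lin[OF frame_tangent(1)]
          lin[OF frame_tangent(2)] lin[OF frame_tangent(3)] frame_combination_linear[symmetric])
         (simp add: algebra_simps)
  qed
  show "minus_structure p u v = 0" if "\<not> (u \<in> tangent_space A p \<and> v \<in> tangent_space A p)" for u v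
    using that by (simp only: minus_structure_def if_False simp_thms)
  show "minus_structure p u v \<in> tangent_space A p"
    if "u \<in> tangent_space A p" "v \<in> tangent_space A p" for u v
    using that frame_tangent sub by (simp add: minus_structure_def subspace_add subspace_scale)
next
  fix X Y assume "X \<in> VF" "Y \<in> VF"
  then show "ev minus_structure X Y \<in> VF" by simp
qed

lemma ambrose_singer_minus_structure: "ambrose_singer A g minus_structure = flat_conn"
proof -
  have "ambrose_singer A g minus_structure X Y = flat_conn X Y" for X Y
  proof (cases "X \<in> VF \<and> Y \<in> VF")
    case True
    then have XY: "X \<in> VF" "Y \<in> VF" by auto
    then show ?thesis
      unfolding ambrose_singer_eq[OF XY]
      by (intro field_eqI) (simp_all add: minus_structure_comps)
  next
    case False
    then show ?thesis
      by (simp only: ambrose_singer_def diag_conn_def if_False simp_thms)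
  qed
  note eq = this
  show ?thesis
    by (rule ext, rule ext, rule eq)
qed

lemma minus_structure_parallel: "parallel_tensor12 A flat_conn minus_structure"
  unfolding parallel_tensor12_def
proof (intro ballI)
  fix X Y Z assume "X \<in> VF" "Y \<in> VF" "Z \<in> VF"
  then show "flat_conn X (ev minus_structure Y Z) - ev minus_structure (flat_conn X Y) Z
      - ev minus_structure Y (flat_conn X Z) = 0"
    by (intro field_eqI) (simp_all add: minus_structure_comps algebra_simps)
qed

lemma minus_structure_homogeneous: "homogeneous_structure A g minus_structure"
  unfolding homogeneous_structure_def ambrose_singer_minus_structure
  using minus_structure_tensor minus_structure_parallel diag_conn_metric[of 0 0 0] flat_conn_curvature
  by simp

lemma tangent_vector_extension:
  assumes u: "u \<in> tangent_space A p"
  obtains X where "X \<in> VF" "X p = u"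
proof
  let ?X = "comb (const_fun (g p u (e1 p))) (const_fun (g p u (e2 p))) (const_fun (g p u (e3 p)))"
  show "?X \<in> VF" by simp
  have "?X p = g p u (e1 p) *\<^sub>R e1 p + g p u (e2 p) *\<^sub>R e2 p + g p u (e3 p) *\<^sub>R e3 p"
    by (simp add: frame_comb_def fmul_def const_fun_def)
  also have "\<dots> = u"
    by (rule tangent_vector_expansion[OF u, symmetric])
  finally show "?X p = u" .
qed

text \<open>Tangent vectors extend to vector fields with constant coefficients in the frame, so a tensor
  field can be read off from its values on vector fields.\<close>

lemma tensor_determined_by_ambrose_singer:
  assumes S: "tensor_field12 A S" and S': "tensor_field12 A S'"
    and eq: "ambrose_singer A g S = ambrose_singer A g S'"
  shows "S = S'"
proof -
  have "S p u v = S' p u v" for p u v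
  proof (cases "u \<in> tangent_space A p \<and> v \<in> tangent_space A p")
    case False
    then have "S p u v = 0" "S' p u v = 0"
      using S S' unfolding tensor_field12_def by blast+
    then show ?thesis by simp
  next
    case True
    obtain X where X: "X \<in> VF" "X p = u"
      using True tangent_vector_extension by blast
    obtain Y where Y: "Y \<in> VF" "Y p = v"
      using True tangent_vector_extension by blast
    have "ambrose_singer A g S X Y = ambrose_singer A g S' X Y"
      by (simp only: eq)
    then have "ev S X Y = ev S' X Y"
      unfolding ambrose_singer_eq[OF X(1) Y(1)] by (rule add_left_imp_eq)
    then have "ev S X Y p = ev S' X Y p"
      by (rule fun_cong)
    then show ?thesis
      unfolding ev_def X(2) Y(2) .
  qed
  note eq = this
  show ?thesis
    by (rule ext, rule ext, rule ext, rule eq)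
qed

lemma span_frame:
  assumes "X \<in> span {e1, e2, e3}"
  obtains a b c where "X = comb (const_fun a) (const_fun b) (const_fun c)"
proof -
  obtain a b c where "X - a *\<^sub>R e1 - b *\<^sub>R e2 = c *\<^sub>R e3"
    using assms unfolding span_insert[of e1] span_insert[of e2] span_singleton by auto
  then have "X = c *\<^sub>R e3 + b *\<^sub>R e2 + a *\<^sub>R e1"
    by (simp only: diff_eq_eq)
  then have "X = comb (const_fun a) (const_fun b) (const_fun c)"
    by (simp only: scaleR_eq_fmul frame_comb_def ac_simps)
  then show thesis by (rule that)
qed

text \<open>Left invariant fields have constant components, which \<open>flat_conn\<close> annihilates. Conversely a
  connection is tensorial in its first argument, so vanishing on pairs of frame fields is vanishing
  of all derivatives of the frame.\<close>

lemma cartan_schouten_minus_eq: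
  assumes lie: "lie_algebra A m = span {e1, e2, e3}"
  shows "cartan_schouten_minus A m = flat_conn"
  unfolding cartan_schouten_minus_def
proof (rule the_equality)
  have "flat_conn X Y = 0" if X: "X \<in> lie_algebra A m" and Y: "Y \<in> lie_algebra A m" for X Y
  proof -
    have "X \<in> VF" using X by (simp add: lie_algebra_def)
    moreover obtain a b c where "Y = comb (const_fun a) (const_fun b) (const_fun c)"
      using Y unfolding lie by (rule span_frame)
    ultimately show ?thesis
      by (intro field_eqI) simp_all
  qed
  then show "linear_connection A flat_conn \<and>
      (\<forall>X\<in>lie_algebra A m. \<forall>Y\<in>lie_algebra A m. flat_conn X Y = 0)"
    using diag_conn_linear_connection by blast
next
  fix D assume D: "linear_connection A D \<and>
      (\<forall>X\<in>lie_algebra A m. \<forall>Y\<in>lie_algebra A m. D X Y = 0)"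
  then have conn: "linear_connection A D" by simp
  have "e1 \<in> lie_algebra A m" "e2 \<in> lie_algebra A m" "e3 \<in> lie_algebra A m"
    unfolding lie by (simp_all add: span_base)
  then have zero: "D e1 e1 = 0" "D e1 e2 = 0" "D e1 e3 = 0" "D e2 e1 = 0" "D e2 e2 = 0" "D e2 e3 = 0"
    "D e3 e1 = 0" "D e3 e2 = 0" "D e3 e3 = 0"
    using D by simp_all
  have tensorial: "D X e = fmul (comp1 X) (D e1 e) + fmul (comp2 X) (D e2 e) + fmul (comp3 X) (D e3 e)"
    if X: "X \<in> VF" and e: "e \<in> VF" for X e
  proof -
    have "D X e = D (comb (comp1 X) (comp2 X) (comp3 X)) e"
      by (rule arg_cong[OF field_expansion[OF X], of "\<lambda>X. D X e"])
    then show ?thesis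
      using X e by (simp add: frame_comb_def linear_connection_add(1)[OF conn] linear_connection_fmul(1)[OF conn])
  qed
  show "D = flat_conn"
    by (rule connection_eq_flat_conn[OF conn]) (simp_all add: tensorial zero)
qed

text \<open>Left translations preserve the frame and the metric, hence components, and the structure has
  constant coefficients.\<close>

lemma minus_structure_left_invariant:
  assumes inv: "left_invariant_metric A m g"
    and lie: "e1 \<in> lie_algebra A m" "e2 \<in> lie_algebra A m" "e3 \<in> lie_algebra A m"
  shows "left_invariant_tensor12 A m minus_structure"
  unfolding left_invariant_tensor12_def
proof (intro allI ballI)
  fix a b u v assume u: "u \<in> tangent_space A b" and v: "v \<in> tangent_space A b"
  let ?P = "pushforward (m a)"
  have lin: "?P (r *\<^sub>R x + s *\<^sub>R y + t *\<^sub>R z) = r *\<^sub>R ?P x + s *\<^sub>R ?P y + t *\<^sub>R ?P z" for r s t x y z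
    by (rule ext) (simp add: pushforward_def scaleR_fun_def)
  have e: "e1 (m a b) = ?P (e1 b)" "e2 (m a b) = ?P (e2 b)" "e3 (m a b) = ?P (e3 b)"
    using lie by (simp_all add: lie_algebra_def)
  have tangent: "?P w \<in> tangent_space A (m a b)" if w: "w \<in> tangent_space A b" for w
  proof -
    have "?P w = ?P (g b w (e1 b) *\<^sub>R e1 b + g b w (e2 b) *\<^sub>R e2 b + g b w (e3 b) *\<^sub>R e3 b)"
      by (rule arg_cong[OF tangent_vector_expansion[OF w]])
    also have "\<dots> = g b w (e1 b) *\<^sub>R e1 (m a b) + g b w (e2 b) *\<^sub>R e2 (m a b) + g b w (e3 b) *\<^sub>R e3 (m a b)"
      by (simp only: lin e)
    also have "\<dots> \<in> tangent_space A (m a b)"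
      using subspace_tangent_space[OF atlas, of "m a b"] frame_tangent[of "m a b"]
      by (simp add: subspace_add subspace_scale)
    finally show ?thesis .
  qed
  have comps: "g (m a b) (?P w) (?P x) = g b w x"
    if "w \<in> tangent_space A b" "x \<in> tangent_space A b" for w x
    using inv that by (simp add: left_invariant_metric_def)
  show "minus_structure (m a b) (?P u) (?P v) = ?P (minus_structure b u v)"
    using u v tangent[OF u] tangent[OF v]
    by (simp only: minus_structure_def simp_thms if_True e lin
        comps[OF _ frame_tangent(1)] comps[OF _ frame_tangent(2)] comps[OF _ frame_tangent(3)])
qed

end
section \<open>Existence and uniqueness of the homogeneous structure\<close>

theorem theorem1p2:
  fixes A :: "('a::{t2_space,second_countable_topology}, real^3) atlas"
    and m :: "'a \<Rightarrow> 'a \<Rightarrow> 'a" and one :: 'a and iv :: "'a \<Rightarrow> 'a"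
    and g :: "'a tensor02"
    and e1 e2 e3 :: "'a vfield"
    and c1 c2 c3 :: real
  assumes "lie_group A m one iv"
    and "unimodular_group m"
    and "riemannian_metric A g"
    and "left_invariant_metric A m g"
    and "distinct [e1, e2, e3]"
    and "basis_of_lie_algebra A m {e1, e2, e3}"
    and "orthonormal_fields g {e1, e2, e3}"
    and "bracket e1 e2 = c3 *\<^sub>R e3"
    and "bracket e2 e3 = c1 *\<^sub>R e1"
    and "bracket e3 e1 = c2 *\<^sub>R e2"
    and "c1 \<noteq> c2" and "c2 \<noteq> c3" and "c1 \<noteq> c3"
  shows "(\<exists>!S. homogeneous_structure A g S) \<and>
    (\<forall>S. homogeneous_structure A g S \<longrightarrow>
       left_invariant_tensor12 A m S \<and>
       ambrose_singer A g S = cartan_schouten_minus A m)"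
proof -
  have lie: "lie_algebra A m = span {e1, e2, e3}"
    using assms(6) by (simp add: basis_of_lie_algebra_def)
  have e_lie: "e1 \<in> lie_algebra A m" "e2 \<in> lie_algebra A m" "e3 \<in> lie_algebra A m"
    unfolding lie by (simp_all add: span_base)
  have "smooth_atlas A"
    using assms(1) by (simp add: lie_group_def)
  moreover have "e1 \<in> vector_fields A" "e2 \<in> vector_fields A" "e3 \<in> vector_fields A"
    using e_lie by (simp_all add: lie_algebra_def)
  ultimately interpret unimodular_frame A g e1 e2 e3 c1 c2 c3
    using assms(3,5,7-10) by unfold_locales (simp_all only: scaleR_eq_fmul)
  have unique: "S = minus_structure" if S: "homogeneous_structure A g S" for S
  proof (rule tensor_determined_by_ambrose_singer)
    show "tensor_field12 A S"
      using S by (simp add: homogeneous_structure_def)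
    show "ambrose_singer A g S = ambrose_singer A g minus_structure"
      using ambrose_singer_eq_flat_conn[OF S assms(11-13)] ambrose_singer_minus_structure
      by (simp only:)
  qed (rule minus_structure_tensor)
  have "left_invariant_tensor12 A m minus_structure"
    by (rule minus_structure_left_invariant[OF assms(4) e_lie])
  moreover have "ambrose_singer A g minus_structure = cartan_schouten_minus A m"
    by (simp only: ambrose_singer_minus_structure cartan_schouten_minus_eq[OF lie])
  ultimately show ?thesis
    using unique minus_structure_homogeneous by blast
qed

end
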